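(* Let $q\in(0,1)$ and $r>0$. Let $G^{\wedge}_{\mathbb{A}_q}(x;r):=g_{\mathbb{A}_q}(q/x,x;r)$ for $x\in(\sqrt{q},1)$, where $g_{\mathbb{A}_q}$ is the unfolded 2-correlation function defined in the context. As $x\to\sqrt{q}$, $$G^{\wedge}_{\mathbb{A}_q}(x;r)\sim c(r)\,(x-\sqrt{q})^{\beta}\quad\text{with }\beta=2,$$ where $$c(r)=\frac{8q_0^4r^3\theta(-qr)^6}{q^2\theta(q)^2\theta(-r)^6}>0.$$
   Context: Notation: $\mathbb{A}_q=\{z\in\mathbb{C}:q<|z|<1\}$, $\theta(z)=\prod_{n=0}^\infty(1-zq^{2n})(1-q^{2n+2}/z)$ for $z\in\mathbb{C}\setminus\{0\}$, $q_0=\prod_{n=1}^\infty(1-q^{2n})$, and for $s>0$, $S_{\mathbb{A}_q}(z,w;s)=\sum_{n\in\mathbb{Z}}\frac{(z\overline{w})^n}{1+sq^{2n}}=\frac{q_0^2\theta(-sz\overline{w})}{\theta(-s)\theta(z\overline{w})}$, $z,w\in\mathbb{A}_q$. Put $$\rho^1_{\mathbb{A}_q}(z;r)=\frac{\theta(-r)}{\theta(-r|z|^4)}S_{\mathbb{A}_q}(z,z;r|z|^2)^2,$$ $$\rho^2_{\mathbb{A}_q}(z_1,z_2;r)=\frac{\theta(-r)}{\theta(-r|z_1|^4|z_2|^4)}\det_{1\le i,j\le2}\big[S_{\mathbb{A}_q}(z_i,z_j;r|z_1|^2|z_2|^2)^2\big]$$ (these are the one- and two-point correlation functions, with respect to Lebesgue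 measure divided by $\pi$, of the zeros of the Gaussian Laurent series $\sum_{n\in\mathbb{Z}}\zeta_nz^n/\sqrt{1+rq^{2n}}$ with i.i.d. standard complex Gaussian $\zeta_n$). The unfolded 2-correlation function is $$g_{\mathbb{A}_q}(z,w;r)=\frac{\rho^2_{\mathbb{A}_q}(z,w;r)}{\rho^1_{\mathbb{A}_q}(z;r)\rho^1_{\mathbb{A}_q}(w;r)},\quad z,w\in\mathbb{A}_q.$$ In the expression for $\rho^2_{\mathbb{A}_q}$ the off-diagonal entries are $S_{\mathbb{A}_q}(z_1,z_2;\cdot)^2$ and its complex conjugate $S_{\mathbb{A}_q}(z_2,z_1;\cdot)^2$. *)

theory Defs
  imports "HOL-Analysis.Analysis" "HOL-Library.Landau_Symbols"
begin

text \<open>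
  The theta function has base \<open>p = q\<^sup>2\<close>. It is polymorphic so that it can be used both for real
  and for complex arguments; only nonzero arguments are meaningful.
\<close>

definition theta :: "real \<Rightarrow> 'a \<Rightarrow> 'a::real_normed_field" where
  "theta q z = (\<Prod>n. (1 - z * of_real (q ^ (2 * n))) * (1 - of_real (q ^ (2 * n + 2)) / z))"

text \<open>The product over \<open>n \<ge> 1\<close> of \<open>1 - q\<^bsup>2n\<^esup>\<close>, with the index shifted to start at 0.\<close>

definition q_zero :: "real \<Rightarrow> real" where
  "q_zero q = (\<Prod>n. 1 - q ^ (2 * (n + 1)))"

text \<open>
  The weighted Szego kernel of the annulus, as a sum over all integers. The sum converges
  absolutely for \<open>q < |z| < 1\<close> and \<open>q < |w| < 1\<close>, since then \<open>q\<^sup>2 < |z w| < 1\<close>.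
\<close>

definition szego_annulus :: "real \<Rightarrow> complex \<Rightarrow> complex \<Rightarrow> real \<Rightarrow> complex" where
  "szego_annulus q z w s =
     (\<Sum>\<^sub>\<infinity>n\<in>(UNIV :: int set). (z * cnj w) powi n / of_real (1 + s * q powi (2 * n)))"

text \<open>
  The correlation functions are densities with respect to Lebesgue measure divided by \<open>\<pi>\<close>,
  so no factor \<open>1 / \<pi>\<close> appears. Their values are real, but they are kept complex-valued,
  as is the kernel.
\<close>

definition rho1 :: "real \<Rightarrow> complex \<Rightarrow> real \<Rightarrow> complex" where
  "rho1 q z r =
     of_real (theta q (- r) / theta q (- r * norm z ^ 4)) *
     (szego_annulus q z z (r * (norm z)\<^sup>2))\<^sup>2"

definition rho2 :: "real \<Rightarrow> complex \<Rightarrow> complex \<Rightarrow> real \<Rightarrow> complex" where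
  "rho2 q z1 z2 r =
     (let S = (\<lambda>z w. szego_annulus q z w (r * (norm z1)\<^sup>2 * (norm z2)\<^sup>2))
      in of_real (theta q (- r) / theta q (- r * norm z1 ^ 4 * norm z2 ^ 4)) *
         det (vector [vector [(S z1 z1)\<^sup>2, (S z1 z2)\<^sup>2],
                      vector [(S z2 z1)\<^sup>2, (S z2 z2)\<^sup>2]] :: complex ^ 2 ^ 2))"

definition unfolded_corr :: "real \<Rightarrow> complex \<Rightarrow> complex \<Rightarrow> real \<Rightarrow> complex" where
  "unfolded_corr q z w r = rho2 q z w r / (rho1 q z r * rho1 q w r)"

definition G_wedge :: "real \<Rightarrow> real \<Rightarrow> real \<Rightarrow> complex" where
  "G_wedge q x r = unfolded_corr q (of_real (q / x)) (of_real x) r"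

definition c_coeff :: "real \<Rightarrow> real \<Rightarrow> real" where
  "c_coeff q r =
     8 * q_zero q ^ 4 * r ^ 3 * theta q (- q * r) ^ 6 /
     (q\<^sup>2 * (theta q q)\<^sup>2 * theta q (- r) ^ 6)"

end

theory Submission
  imports Defs "HOL-Real_Asymp.Real_Asymp" "HOL-Computational_Algebra.Polynomial"
begin

text \<open>
  For \<open>z = q / x\<close>, \<open>w = x\<close>, \<open>u = x\<^sup>2\<close>, \<open>s = r q\<^sup>2\<close> and \<open>F u = \<Sum> u\<^bsup>n\<^esup> / (1 + s q\<^bsup>2n\<^esup>)\<close>, the determinant
  is \<open>(F u * F (q\<^sup>2 / u))\<^sup>2 - (F q)\<^sup>4\<close>, so everything rests on the defect \<open>F u * F (q\<^sup>2 / u) - (F q)\<^sup>2\<close>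
  near \<open>u = q\<close>. Written as a double series over \<open>n, m\<close> and summed along \<open>d = n - m\<close>, it telescopes to
  \<open>1 / s * \<Sum> d q\<^bsup>d\<^esup> / (1 - q\<^bsup>2d\<^esup>) * ((u / q)\<^bsup>d\<^esup> - 1)\<close>, whose second-order term in \<open>u / q - 1\<close> is governed by
  the Lambert series \<open>W = \<Sum> d\<^sup>3 q\<^bsup>d\<^esup> / (1 - q\<^bsup>2d\<^esup>)\<close>. As \<open>W\<close> does not depend on \<open>s\<close>, it can be computed at
  \<open>s = - 1 / q\<close>, where \<open>F q = 0\<close> and \<open>W\<close> becomes a square.

  The product formula for \<open>F q\<close>, and the value of this square, come from the partial fraction
  expansion of the truncated theta quotient \<open>theta q (- q s) / theta q (- s)\<close> in \<open>s\<close>.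
\<close>

section \<open>Series over the integers\<close>

text \<open>The exponent is 2 because \<open>u = q\<close> is the fixed point of
  \<open>u \<mapsto> q^2 / u\<close>: the weights \<open>d q^d / (1 - q^(2d))\<close> are even in
  \<open>d\<close>, so \<open>d\<close> and \<open>-d\<close> combine to
  \<open>v^d + v^(-d) - 2\<close> with \<open>v = u / q\<close>, a double zero at
  \<open>v = 1\<close>. The determinant is the defect \<open>D\<close> times
  \<open>D + 2 (F q)^2\<close>, and the second factor has a nonzero limit. The parameter
  \<open>s\<close> survives the telescoping only as the prefactor \<open>1 / s\<close>, so nothing
  forces it to be positive; hence the coefficient lemmas assume only that no denominator vanishes.
  At \<open>s = - 1 / q\<close>, expanding \<open>(n - m)^2\<close> leaves just the square of a
  first moment. That moment is \<open>- 1 / q\<close> times the derivative of \<open>F q\<close> in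
  \<open>s\<close> at its zero, and it is found by cancelling the vanishing factor of the truncated
  quotient instead of differentiating. Truncation turns the partial fraction expansion into
  polynomial interpolation. Its price is a weight on each term, which tends to \<open>w^2\<close>
  for \<open>w = theta_weight_lim q\<close>. Since \<open>w^2 = theta(q) / q_0^2\<close>, every
  theta constant apart from \<open>theta(-r)\<close> and \<open>theta(-q r)\<close> enters through a
  power of \<open>w\<close>.\<close>

lemma tendsto_infsum_dominated:
  fixes f :: "'a \<Rightarrow> 'i \<Rightarrow> 'b::banach"
  assumes M: "M summable_on A"
    and bound: "\<forall>\<^sub>F a in F. \<forall>i\<in>A. norm (f a i) \<le> M i"
    and lim: "\<And>i. i \<in> A \<Longrightarrow> ((\<lambda>a. f a i) \<longlongrightarrow> g i) F"
  shows "((\<lambda>a. infsum (f a) A) \<longlongrightarrow> infsum g A) F"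
proof (cases "F = bot")
  case False
  \<comment> \<open>All functions dominated by \<open>M\<close> together form the parameter set of
    the Weierstrass M-test, so a single finite \<open>X\<close> controls the tails of every
    \<open>f a\<close> and of \<open>g\<close>.\<close>
  define Y where "Y = {h :: 'i \<Rightarrow> 'b. \<forall>i\<in>A. norm (h i) \<le> M i}"
  have unif: "uniform_limit Y (\<lambda>X h. \<Sum>i\<in>X. h i) (\<lambda>h. infsum h A) (finite_subsets_at_top A)"
    using M by (intro Weierstrass_m_test_general) (auto simp: Y_def)
  have "norm (g i) \<le> M i" if "i \<in> A" for i
    by (rule tendsto_upperbound[OF tendsto_norm[OF lim[OF that]] eventually_mono[OF bound] False])
      (use that in auto)
  then have gY: "g \<in> Y" by (simp add: Y_def)
  show ?thesis
  proof (rule tendstoI)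
    fix e :: real assume "e > 0"
    then have "\<forall>\<^sub>F X in finite_subsets_at_top A. \<forall>h\<in>Y. dist (\<Sum>i\<in>X. h i) (infsum h A) < e / 3"
      using uniform_limitD[OF unif, of "e / 3"] by simp
    then obtain X where X: "finite X" "X \<subseteq> A"
      and "\<forall>Z. finite Z \<and> X \<subseteq> Z \<and> Z \<subseteq> A \<longrightarrow> (\<forall>h\<in>Y. dist (\<Sum>i\<in>Z. h i) (infsum h A) < e / 3)"
      unfolding eventually_finite_subsets_at_top by (elim exE conjE)
    then have h: "dist (\<Sum>i\<in>X. h i) (infsum h A) < e / 3" if "h \<in> Y" for h
      using that by simp
    have "((\<lambda>a. \<Sum>i\<in>X. f a i) \<longlongrightarrow> (\<Sum>i\<in>X. g i)) F"
      using X lim by (intro tendsto_sum) auto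
    then have "\<forall>\<^sub>F a in F. dist (\<Sum>i\<in>X. f a i) (\<Sum>i\<in>X. g i) < e / 3"
      using \<open>e > 0\<close> by (intro tendstoD) auto
    moreover have "\<forall>\<^sub>F a in F. f a \<in> Y"
      using bound by (simp add: Y_def)
    ultimately show "\<forall>\<^sub>F a in F. dist (infsum (f a) A) (infsum g A) < e"
    proof eventually_elim
      case (elim a)
      have "dist (infsum (f a) A) (infsum g A) \<le> dist (\<Sum>i\<in>X. f a i) (infsum (f a) A)
          + dist (\<Sum>i\<in>X. f a i) (\<Sum>i\<in>X. g i) + dist (\<Sum>i\<in>X. g i) (infsum g A)"
        using dist_triangle[of "infsum (f a) A" "infsum g A" "\<Sum>i\<in>X. f a i"]
          dist_triangle[of "\<Sum>i\<in>X. f a i" "infsum g A" "\<Sum>i\<in>X. g i"]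
        by (simp add: dist_commute)
      then show ?case using h[OF elim(2)] h[OF gY] elim(1) by linarith
    qed
  qed
qed auto

lemma summable_on_int:
  fixes f :: "int \<Rightarrow> real"
  assumes "(\<lambda>n. f (int n)) summable_on UNIV" "(\<lambda>n. f (- int n)) summable_on UNIV"
  shows "f summable_on UNIV"
proof -
  have "f summable_on range int"
    using assms(1) by (subst summable_on_reindex) (auto simp: o_def)
  moreover have "f summable_on range (\<lambda>n. - int n)"
    using assms(2) by (subst summable_on_reindex) (auto simp: o_def inj_on_def)
  moreover have "range int \<union> range (\<lambda>n. - int n) = UNIV"
  proof -
    have "x \<in> range int \<union> range (\<lambda>n. - int n)" for x :: int
      by (cases x rule: int_cases2) auto
    then show ?thesis by blast
  qed
  ultimately show ?thesis
    using summable_on_union[of f "range int" "range (\<lambda>n. - int n)"] by (simp only:)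
qed

lemma summable_on_int_power_abs:
  fixes \<rho> :: real
  assumes "0 < \<rho>" "\<rho> < 1"
  shows "(\<lambda>n::int. real_of_int \<bar>n\<bar> ^ k * \<rho> ^ nat \<bar>n\<bar>) summable_on UNIV"
proof -
  \<comment> \<open>Splitting \<open>\<rho>\<close> as \<open>sqrt \<rho> * sqrt \<rho>\<close>, one
    half of the decay absorbs the polynomial factor.\<close>
  have "(\<lambda>n. real n ^ k * \<rho> ^ n) \<in> O(\<lambda>n. sqrt \<rho> ^ n)"
  proof -
    have "(\<lambda>n. real n ^ k * sqrt \<rho> ^ n) \<longlonglongrightarrow> 0"
    proof -
      have "0 < sqrt \<rho>" "sqrt \<rho> < 1" using assms by auto
      then show ?thesis by real_asymp
    qed
    then have "(\<lambda>n. real n ^ k * sqrt \<rho> ^ n) \<in> O(\<lambda>_. 1)"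
      by (intro bigoI_tendsto[where c = 0]) auto
    from landau_o.big.mult_right[OF this, of "\<lambda>n. sqrt \<rho> ^ n"]
    show ?thesis using assms by (simp add: mult.assoc flip: power_mult_distrib)
  qed
  moreover have "summable (\<lambda>n. norm (sqrt \<rho> ^ n))"
    using assms by (simp add: norm_power summable_geometric)
  ultimately have "summable (\<lambda>n. real n ^ k * \<rho> ^ n)"
    using summable_comparison_test_bigo by blast
  then have "(\<lambda>n. real n ^ k * \<rho> ^ n) summable_on UNIV"
    using assms by (subst summable_on_UNIV_nonneg_real_iff) auto
  then show ?thesis
    by (intro summable_on_int) auto
qed

lemma summable_on_int_comparison:
  fixes f :: "int \<Rightarrow> real"
  assumes "0 < \<rho>" "\<rho> < 1" "\<And>n. \<bar>f n\<bar> \<le> C * (real_of_int \<bar>n\<bar> ^ k * \<rho> ^ nat \<bar>n\<bar>)"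
  shows "f summable_on UNIV"
proof -
  have "(\<lambda>n. C * (real_of_int \<bar>n\<bar> ^ k * \<rho> ^ nat \<bar>n\<bar>)) summable_on UNIV"
    by (intro summable_on_cmult_right summable_on_int_power_abs assms)
  then have "(\<lambda>n. norm (f n)) summable_on UNIV"
    by (rule summable_on_comparison_test) (use assms in auto)
  then show ?thesis by (rule abs_summable_summable)
qed

text \<open>An unconditional sum may be evaluated along any exhaustion. The half-open intervals are
  chosen because unit increments over them telescope to exactly
  \<open>f N - f (- N)\<close>.\<close>

lemma filterlim_int_interval_at_top:
  "filterlim (\<lambda>N. {- int N..<int N}) (finite_subsets_at_top UNIV) sequentially"
  unfolding filterlim_finite_subsets_at_top
proof (intro allI impI)
  fix X :: "int set" assume X: "finite X \<and> X \<subseteq> UNIV"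
  define B where "B = Max (insert 0 ((\<lambda>x. nat \<bar>x\<bar>) ` X)) + 1"
  have "x \<in> {- int N..<int N}" if "N \<ge> B" "x \<in> X" for x N
  proof -
    have "nat \<bar>x\<bar> \<le> Max (insert 0 ((\<lambda>x. nat \<bar>x\<bar>) ` X))" using X that by (intro Max_ge) auto
    then show ?thesis using that unfolding B_def by auto
  qed
  then show "\<forall>\<^sub>F N in sequentially. finite {- int N..<int N} \<and> X \<subseteq> {- int N..<int N} \<and> {- int N..<int N} \<subseteq> UNIV"
    by (intro eventually_sequentiallyI[of B]) auto
qed

lemma infsum_int_telescope_1:
  fixes f :: "int \<Rightarrow> real"
  assumes "(\<lambda>m. f (m + 1) - f m) summable_on UNIV"
    and "(\<lambda>N. f (int N)) \<longlonglongrightarrow> a" "(\<lambda>N. f (- int N)) \<longlonglongrightarrow> b"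
  shows "(\<Sum>\<^sub>\<infinity>m. f (m + 1) - f m) = a - b"
proof -
  have sum: "(\<Sum>m\<in>{- int N..<int N}. f (m + 1) - f m) = f (int N) - f (- int N)" for N
  proof (induction N)
    case (Suc N)
    have "{- int (Suc N)..<int (Suc N)} = insert (- int (Suc N)) (insert (int N) {- int N..<int N})"
      by auto
    then show ?case using Suc by (simp add: add.commute)
  qed simp
  have "((\<lambda>X. \<Sum>m\<in>X. f (m + 1) - f m) \<longlongrightarrow> (\<Sum>\<^sub>\<infinity>m. f (m + 1) - f m)) (finite_subsets_at_top UNIV)"
    using assms(1) by (rule infsum_tendsto)
  from filterlim_compose[OF this filterlim_int_interval_at_top]
  have "(\<lambda>N. f (int N) - f (- int N)) \<longlonglongrightarrow> (\<Sum>\<^sub>\<infinity>m. f (m + 1) - f m)"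
    unfolding sum .
  with tendsto_diff[OF assms(2,3)] show ?thesis
    using LIMSEQ_unique by blast
qed

lemma infsum_int_shift:
  fixes f :: "int \<Rightarrow> 'a::{comm_monoid_add,t2_space}"
  shows "(\<Sum>\<^sub>\<infinity>m. f (m + d)) = (\<Sum>\<^sub>\<infinity>m. f m)"
  by (rule infsum_reindex_bij_witness[of _ "\<lambda>m. m - d" "\<lambda>m. m + d"]) auto

lemma summable_on_int_shift:
  fixes f :: "int \<Rightarrow> 'a::{comm_monoid_add,t2_space}"
  shows "(\<lambda>m. f (m + d)) summable_on UNIV \<longleftrightarrow> f summable_on UNIV"
  by (rule summable_on_reindex_bij_witness[of _ "\<lambda>m. m - d" "\<lambda>m. m + d"]) auto

text \<open>Raising \<open>d\<close> by 1 adds a shifted copy of the unit-step series, so the sum is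
  additive in \<open>d\<close>; induction in both directions covers negative shifts.\<close>

lemma infsum_int_telescope:
  fixes f :: "int \<Rightarrow> real"
  assumes sm: "\<And>d. (\<lambda>m. f (m + d) - f m) summable_on UNIV"
    and lim: "(\<lambda>N. f (int N)) \<longlonglongrightarrow> a" "(\<lambda>N. f (- int N)) \<longlonglongrightarrow> b"
  shows "(\<Sum>\<^sub>\<infinity>m. f (m + d) - f m) = of_int d * (a - b)"
proof -
  define T where "T d = (\<Sum>\<^sub>\<infinity>m. f (m + d) - f m)" for d
  have step: "T (d + 1) = T d + (a - b)" for d
  proof -
    have "T (d + 1) = (\<Sum>\<^sub>\<infinity>m. (f (m + d) - f m) + (f (m + d + 1) - f (m + d)))"
      unfolding T_def by (intro infsum_cong) (simp add: add.assoc)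
    also have "\<dots> = T d + (\<Sum>\<^sub>\<infinity>m. f (m + d + 1) - f (m + d))"
      unfolding T_def
      using sm[of 1] summable_on_int_shift[of "\<lambda>m. f (m + 1) - f m" d]
      by (intro infsum_add sm) auto
    also have "(\<Sum>\<^sub>\<infinity>m. f (m + d + 1) - f (m + d)) = a - b"
      using infsum_int_shift[of "\<lambda>m. f (m + 1) - f m" d] infsum_int_telescope_1[OF sm lim] by simp
    finally show ?thesis .
  qed
  have "T d = of_int d * (a - b)"
  proof (induction d rule: int_induct[where k = 0])
    case base show ?case by (simp add: T_def)
  next
    case (step1 i) then show ?case using step[of i] by (simp add: algebra_simps)
  next
    case (step2 i) then show ?case using step[of "i - 1"] by (simp add: algebra_simps)
  qed
  then show ?thesis by (simp add: T_def)
qed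

section \<open>Telescoping double series\<close>

text \<open>The terms of \<open>F\<close> at the fixed point \<open>u = q\<close>. The weight
  \<open>s\<close> is kept general since it is later taken negative.\<close>

definition szego_coeff :: "real \<Rightarrow> real \<Rightarrow> int \<Rightarrow> real" where
  "szego_coeff q s n = q powi n / (1 + s * q powi (2 * n))"

text \<open>The summand is even in \<open>d\<close> and its term at \<open>d = 0\<close> is
  \<open>0 / 0 = 0\<close>, so this is twice the usual Lambert series over
  \<open>d \<ge> 1\<close>.\<close>

definition lambert_cubic :: "real \<Rightarrow> real" where
  "lambert_cubic q = (\<Sum>\<^sub>\<infinity>d::int. of_int d ^ 3 * q powi d / (1 - q powi (2 * d)))"

lemma infsum_product_real:
  fixes f :: "'a \<Rightarrow> real" and g :: "'b \<Rightarrow> real"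
  assumes "f summable_on A" "g summable_on B"
  shows "(\<lambda>(x, y). f x * g y) summable_on A \<times> B"
    and "(\<Sum>\<^sub>\<infinity>(x, y)\<in>A \<times> B. f x * g y) = infsum f A * infsum g B"
proof -
  have f: "(\<lambda>x. norm (f x)) summable_on A" and g: "(\<lambda>y. norm (g y)) summable_on B"
    using assms summable_on_iff_abs_summable_on_real by blast+
  have "(\<lambda>(x, y). norm (f x) * norm (g y)) summable_on A \<times> B"
    by (rule summable_on_SigmaI[where g = "\<lambda>x. norm (f x) * (\<Sum>\<^sub>\<infinity>y\<in>B. norm (g y))"])
      (use f g in \<open>auto intro!: has_sum_cmult_right summable_on_cmult_left has_sum_infsum\<close>)
  then have "(\<lambda>z. norm (case z of (x, y) \<Rightarrow> f x * g y)) summable_on A \<times> B"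
    by (simp add: case_prod_unfold abs_mult)
  then show *: "(\<lambda>(x, y). f x * g y) summable_on A \<times> B"
    by (rule abs_summable_summable)
  show "(\<Sum>\<^sub>\<infinity>(x, y)\<in>A \<times> B. f x * g y) = infsum f A * infsum g B"
    using infsum_Sigma'_banach[OF *] by (simp add: infsum_cmult_right' infsum_cmult_left')
qed

lemma summable_on_szego_coeff:
  assumes "0 < q" "q < 1" and C: "\<And>n. \<bar>szego_coeff q s n\<bar> \<le> C * q ^ nat \<bar>n\<bar>"
  shows "(\<lambda>n. of_int n ^ k * szego_coeff q s n) summable_on UNIV"
proof (rule summable_on_int_comparison[OF assms(1,2)])
  fix n :: int
  show "\<bar>of_int n ^ k * szego_coeff q s n\<bar> \<le> C * (real_of_int \<bar>n\<bar> ^ k * q ^ nat \<bar>n\<bar>)"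
    using mult_left_mono[OF C[of n], of "real_of_int \<bar>n\<bar> ^ k"]
    by (simp add: abs_mult power_abs mult_ac)
qed

text \<open>The product \<open>c\<^bsub>m+d\<^esub> c\<^bsub>m\<^esub>\<close> is a multiple of the increment of \<open>1 / (1 + s q\<^bsup>2m\<^esup>)\<close> from \<open>m\<close> to
  \<open>m + d\<close>, and this function tends to 0 at \<open>- \<infinity>\<close> and to 1 at \<open>\<infinity>\<close>.\<close>

lemma szego_coeff_autocorrelation:
  assumes q: "0 < q" "q < 1" and s: "s \<noteq> 0" and nz: "\<And>n. 1 + s * q powi (2 * n) \<noteq> 0"
    and C: "\<And>n. \<bar>szego_coeff q s n\<bar> \<le> C * q ^ nat \<bar>n\<bar>"
    and d: "d \<noteq> 0"
  shows "(\<Sum>\<^sub>\<infinity>m. szego_coeff q s (m + d) * szego_coeff q s m) = of_int d * q powi d / (s * (1 - q powi (2 * d)))"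
proof -
  define c where "c = szego_coeff q s"
  define f where "f m = 1 / (1 + s * q powi (2 * m))" for m
  have c_sum: "c summable_on UNIV"
    using summable_on_szego_coeff[OF q C, of 0] by (simp add: c_def)
  \<comment> \<open>Needed for every shift \<open>e\<close> and not just for \<open>d\<close>,
    because the telescoping lemma moves through all shifts.\<close>
  have diff: "f (m + e) - f m = s * (1 - q powi (2 * e)) / q powi e * (c (m + e) * c m)" for m e
  proof -
    have "s * (1 - q powi (2 * e)) / q powi e * (c (m + e) * c m) =
        s * (1 - q powi (2 * e)) * (q powi m * q powi m)
          / ((1 + s * q powi (2 * (m + e))) * (1 + s * q powi (2 * m)))"
      using q by (simp add: c_def szego_coeff_def power_int_add)
    also have "q powi m * q powi m = q powi (2 * m)"
      using q by (simp flip: power_int_add)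
    also have "s * (1 - q powi (2 * e)) * q powi (2 * m) / ((1 + s * q powi (2 * (m + e))) * (1 + s * q powi (2 * m)))
        = f (m + e) - f m"
    proof -
      have "s * (1 - Y) * X / ((1 + s * (X * Y)) * (1 + s * X)) = 1 / (1 + s * (X * Y)) - 1 / (1 + s * X)"
        if "1 + s * X \<noteq> 0" "1 + s * (X * Y) \<noteq> 0" for X Y
        using that by (subst diff_frac_eq) (auto simp: algebra_simps)
      moreover have "q powi (2 * (m + e)) = q powi (2 * m) * q powi (2 * e)"
        using q by (simp add: distrib_left power_int_add)
      ultimately show ?thesis using nz[of m] nz[of "m + e"] by (simp add: f_def)
    qed
    finally show ?thesis by simp
  qed
  have cc_sum: "(\<lambda>m. c (m + e) * c m) summable_on UNIV" for e
  proof -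
    have "norm (c (m + e) * c m) \<le> C * norm (c m)" for m
    proof -
      have "\<bar>c (m + e)\<bar> \<le> C * q ^ nat \<bar>m + e\<bar>" using C by (simp add: c_def)
      also have "\<dots> \<le> C * 1"
        using q C[of 0] by (intro mult_left_mono power_le_one) auto
      finally show ?thesis by (simp add: abs_mult mult_right_mono)
    qed
    moreover have "(\<lambda>m. norm (c m)) summable_on UNIV"
      using c_sum summable_on_iff_abs_summable_on_real by blast
    then have "(\<lambda>m. C * norm (c m)) summable_on UNIV"
      by (rule summable_on_cmult_right)
    ultimately have "(\<lambda>m. norm (c (m + e) * c m)) summable_on UNIV"
      by (metis (no_types, lifting) summable_on_comparison_test norm_ge_zero)
    then show ?thesis by (rule abs_summable_summable)
  qed
  have q2: "0 \<le> q\<^sup>2" "q\<^sup>2 < 1"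
    using power_strict_mono[of q 1 2] q by simp_all
  have "(\<Sum>\<^sub>\<infinity>m. f (m + d) - f m) = of_int d * (1 - 0)"
  proof (rule infsum_int_telescope)
    show "(\<lambda>m. f (m + e) - f m) summable_on UNIV" for e
      unfolding diff by (intro summable_on_cmult_right cc_sum)
    have "(\<lambda>N. 1 / (1 + s * (q\<^sup>2) ^ N)) \<longlonglongrightarrow> 1 / (1 + s * 0)"
      by (intro tendsto_intros LIMSEQ_realpow_zero q2) auto
    then show "(\<lambda>N. f (int N)) \<longlonglongrightarrow> 1"
      by (simp add: f_def power_int_mult)
    have "(\<lambda>N. (q\<^sup>2) ^ N / ((q\<^sup>2) ^ N + s)) \<longlonglongrightarrow> 0 / (0 + s)"
      using s by (intro tendsto_intros LIMSEQ_realpow_zero q2) auto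
    moreover have "f (- int N) = (q\<^sup>2) ^ N / ((q\<^sup>2) ^ N + s)" for N
    proof -
      have "q powi (2 * - int N) = 1 / (q\<^sup>2) ^ N"
        by (subst power_int_mult) (simp add: power_int_minus divide_inverse)
      then have "f (- int N) = 1 / (1 + s * (1 / (q\<^sup>2) ^ N))"
        by (simp only: f_def)
      also have "\<dots> = (q\<^sup>2) ^ N / ((q\<^sup>2) ^ N + s)"
        using q by (simp add: divide_simps)
      finally show ?thesis .
    qed
    ultimately show "(\<lambda>N. f (- int N)) \<longlonglongrightarrow> 0" by simp
  qed
  then have "s * (1 - q powi (2 * d)) / q powi d * (\<Sum>\<^sub>\<infinity>m. c (m + d) * c m) = of_int d"
    unfolding diff infsum_cmult_right' by simp
  moreover have "q powi (2 * d) \<noteq> 1"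
    using power_int_strict_decreasing[of 0 "2 * d" q] power_int_strict_decreasing[of "2 * d" 0 q] q d
    by (cases "d > 0") auto
  ultimately show ?thesis using q s by (simp add: c_def field_simps)
qed

text \<open>A general \<open>\<phi>\<close> lets one identity serve both \<open>v^d - 1\<close> and
  \<open>d^2\<close>. The condition \<open>\<phi> 0 = 0\<close> removes the diagonal
  \<open>n = m\<close>, where the sum of squares of the coefficients is positive or divergent in
  general, while the closed form reads \<open>0 / 0 = 0\<close>.\<close>

lemma infsum_szego_coeff_double:
  assumes q: "0 < q" "q < 1" and s: "s \<noteq> 0" and nz: "\<And>n. 1 + s * q powi (2 * n) \<noteq> 0"
    and C: "\<And>n. \<bar>szego_coeff q s n\<bar> \<le> C * q ^ nat \<bar>n\<bar>"
    and \<phi>: "\<phi> 0 = 0"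
    and sm: "(\<lambda>(n, m). szego_coeff q s n * szego_coeff q s m * \<phi> (n - m)) summable_on UNIV \<times> UNIV"
  shows "(\<Sum>\<^sub>\<infinity>(n, m)\<in>UNIV \<times> UNIV. szego_coeff q s n * szego_coeff q s m * \<phi> (n - m))
    = (\<Sum>\<^sub>\<infinity>d. of_int d * q powi d / (1 - q powi (2 * d)) * \<phi> d) / s"
proof -
  define c where "c = szego_coeff q s"
  have bij: "bij_betw (\<lambda>(d, m). (m + d, m)) (UNIV \<times> UNIV) (UNIV \<times> (UNIV :: int set))"
    by (rule bij_betwI[where g = "\<lambda>(n, m). (n - m, m)"]) auto
  have eq: "(\<lambda>p. (\<lambda>(n, m). c n * c m * \<phi> (n - m)) ((\<lambda>(d, m). (m + d, m)) p))
      = (\<lambda>(d, m). c (m + d) * c m * \<phi> d)"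
    by (auto simp: fun_eq_iff)
  have sm': "(\<lambda>(d, m). c (m + d) * c m * \<phi> d) summable_on UNIV \<times> UNIV"
    using summable_on_reindex_bij_betw[OF bij, of "\<lambda>(n, m). c n * c m * \<phi> (n - m)"] sm
    unfolding eq by (simp add: c_def case_prod_unfold)
  have "(\<Sum>\<^sub>\<infinity>(n, m)\<in>UNIV \<times> UNIV. c n * c m * \<phi> (n - m)) = (\<Sum>\<^sub>\<infinity>(d, m)\<in>UNIV \<times> UNIV. c (m + d) * c m * \<phi> d)"
    using infsum_reindex_bij_betw[OF bij, of "\<lambda>(n, m). c n * c m * \<phi> (n - m)"] unfolding eq by simp
  also have "\<dots> = (\<Sum>\<^sub>\<infinity>d. \<Sum>\<^sub>\<infinity>m. c (m + d) * c m * \<phi> d)"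
    using infsum_Sigma'_banach[OF sm'] by simp
  also have "\<dots> = (\<Sum>\<^sub>\<infinity>d. of_int d * q powi d / (1 - q powi (2 * d)) * \<phi> d / s)"
  proof (intro infsum_cong)
    fix d :: int
    show "(\<Sum>\<^sub>\<infinity>m. c (m + d) * c m * \<phi> d) = of_int d * q powi d / (1 - q powi (2 * d)) * \<phi> d / s"
    proof (cases "d = 0")
      case False
      have "(\<Sum>\<^sub>\<infinity>m. c (m + d) * c m * \<phi> d) = (\<Sum>\<^sub>\<infinity>m. c (m + d) * c m) * \<phi> d"
        by (rule infsum_cmult_left')
      also have "(\<Sum>\<^sub>\<infinity>m. c (m + d) * c m) = of_int d * q powi d / (s * (1 - q powi (2 * d)))"
        unfolding c_def by (rule szego_coeff_autocorrelation[OF q s nz C False])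
      finally show ?thesis by (simp add: mult_ac)
    qed (simp add: \<phi>)
  qed
  finally show ?thesis
    by (simp add: c_def divide_inverse infsum_cmult_left')
qed

section \<open>The kernel at positive real arguments\<close>

definition szego_sum :: "real \<Rightarrow> real \<Rightarrow> real \<Rightarrow> real" where
  "szego_sum q u s = (\<Sum>\<^sub>\<infinity>n::int. u powi n / (1 + s * q powi (2 * n)))"

text \<open>Each tail has its own lower bound for the denominator: 1 for \<open>n \<ge> 0\<close>,
  and \<open>s * q powi (2 * n)\<close> for \<open>n < 0\<close>, which turns
  \<open>u powi n\<close> into a power of \<open>q^2 / u\<close>. A separate \<open>\<rho>\<close>
  makes the bound uniform when \<open>u\<close> varies near \<open>q\<close>.\<close>

lemma szego_term_bound:
  fixes q s u :: real
  assumes "0 < q" "0 < s" "0 < u" "u \<le> \<rho>" "q\<^sup>2 / u \<le> \<rho>"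
  shows "\<bar>u powi n / (1 + s * q powi (2 * n))\<bar> \<le> max 1 (1 / s) * \<rho> ^ nat \<bar>n\<bar>"
proof -
  have pos: "0 < q powi (2 * n)" using assms(1) by (rule zero_less_power_int)
  have ge1: "1 + s * q powi (2 * n) \<ge> 1" using assms pos by simp
  then have gt0: "0 < (1 + s * q powi (2 * n)) * 1"
    using less_le_trans[OF zero_less_one] by (simp only: mult_1_right)
  show ?thesis
  proof (cases "n \<ge> 0")
    case True
    then obtain k where n: "n = int k" by (metis nonneg_int_cases)
    have "u ^ k / (1 + s * q powi (2 * n)) \<le> u ^ k / 1"
      by (rule divide_left_mono[OF ge1]) (use assms gt0 in simp_all)
    also have "\<dots> \<le> \<rho> ^ k" using assms by (simp add: power_mono)
    also have "\<dots> \<le> max 1 (1 / s) * \<rho> ^ k"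
      using mult_right_mono[of 1 "max 1 (1 / s)" "\<rho> ^ k"] assms by simp
    finally show ?thesis using assms ge1 by (simp add: n)
  next
    case False
    then obtain k where n: "n = - int k" by (metis int_cases2 of_nat_0_le_iff)
    have "u powi n / (1 + s * q powi (2 * n)) \<le> u powi n / (s * q powi (2 * n))"
      using assms pos by (intro divide_left_mono mult_pos_pos add_pos_pos) auto
    also have "\<dots> = (1 / s) * (q\<^sup>2 / u) ^ k"
      using assms
      by (simp add: n power_int_minus power_int_mult power_divide field_simps flip: power_mult)
    also have "\<dots> \<le> (1 / s) * \<rho> ^ k"
      using assms by (intro mult_left_mono power_mono) auto
    also have "\<dots> \<le> max 1 (1 / s) * \<rho> ^ k"
      using assms by (intro mult_right_mono) auto
    finally show ?thesis using assms ge1 by (simp add: n)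
  qed
qed

lemma summable_on_szego_term:
  fixes q s u :: real
  assumes "0 < q" "0 < s" "q\<^sup>2 < u" "u < 1"
  shows "(\<lambda>n. u powi n / (1 + s * q powi (2 * n))) summable_on UNIV"
proof -
  have "q\<^sup>2 > 0" using assms(1) by (rule zero_less_power)
  then have u: "u > 0" using assms by linarith
  define \<rho> where "\<rho> = max u (q\<^sup>2 / u)"
  show ?thesis
    by (rule summable_on_int_comparison[where \<rho> = \<rho> and C = "max 1 (1 / s)" and k = 0])
      (use assms u szego_term_bound[of q s u \<rho>] in \<open>auto simp: \<rho>_def\<close>)
qed

lemma szego_coeff_bound:
  assumes "0 < q" "0 < s"
  shows "\<bar>szego_coeff q s n\<bar> \<le> max 1 (1 / s) * q ^ nat \<bar>n\<bar>"
  unfolding szego_coeff_def using assms by (intro szego_term_bound) (auto simp: power2_eq_square)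

lemma szego_sum_product:
  assumes q: "0 < q" "q < 1" and s: "0 < s" and u: "q\<^sup>2 < u" "u < 1"
  shows "szego_sum q u s * szego_sum q (q\<^sup>2 / u) s - (szego_sum q q s)\<^sup>2
    = (\<Sum>\<^sub>\<infinity>d. of_int d * q powi d / (1 - q powi (2 * d)) * ((u / q) powi d - 1)) / s"
proof -
  define c where "c = szego_coeff q s"
  have "q\<^sup>2 > 0" using q by simp
  then have u0: "u > 0" using u by linarith
  have u': "q\<^sup>2 < q\<^sup>2 / u" "q\<^sup>2 / u < 1" using q u u0 by (simp_all add: field_simps)
  have q2: "q\<^sup>2 < q" using q by (simp add: power2_eq_square)
  have nz: "1 + s * q powi (2 * n) \<noteq> 0" for n
    using s q by (metis add_pos_pos less_irrefl mult_pos_pos zero_less_one zero_less_power_int)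
  define f where "f n = u powi n / (1 + s * q powi (2 * n))" for n
  define g where "g n = (q\<^sup>2 / u) powi n / (1 + s * q powi (2 * n))" for n
  have f: "f summable_on UNIV" and g: "g summable_on UNIV" and c: "c summable_on UNIV"
    unfolding f_def g_def c_def szego_coeff_def
    using q s u u' q2 by (intro summable_on_szego_term; simp)+
  \<comment> \<open>With \<open>v = u / q\<close> one has \<open>q^2 / u = q / v\<close>, so the two
    kernels have the terms \<open>c n * v^n\<close> and \<open>c m * v^(-m)\<close>; the defect
    weights the double series of \<open>(F q)^2\<close> by \<open>v^(n-m) - 1\<close>.\<close>
  have split: "c n * c m * ((u / q) powi (n - m) - 1) = f n * g m - c n * c m" for n m
  proof -
    have "f n = c n * (u / q) powi n"
      using q by (simp add: f_def c_def szego_coeff_def power_int_divide_distrib)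
    moreover have "g m = c m * (u / q) powi (- m)"
      using q u0 by (simp add: g_def c_def szego_coeff_def power_int_divide_distrib power_int_minus
          power2_eq_square power_int_mult_distrib)
    moreover have "(u / q) powi (n - m) = (u / q) powi n * (u / q) powi (- m)"
      using q u0 by (simp flip: power_int_add)
    ultimately show ?thesis by (simp add: algebra_simps)
  qed
  have eq: "(\<lambda>(n, m). c n * c m * ((u / q) powi (n - m) - 1))
      = (\<lambda>p. (case p of (n, m) \<Rightarrow> f n * g m) + - (case p of (n, m) \<Rightarrow> c n * c m))"
    by (auto simp: split)
  have sm: "(\<lambda>(n, m). c n * c m * ((u / q) powi (n - m) - 1)) summable_on UNIV \<times> UNIV"
    unfolding eq
    by (intro summable_on_add infsum_product_real(1) f g)
      (simp only: summable_on_uminus infsum_product_real(1)[OF c c])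
  have "szego_sum q u s * szego_sum q (q\<^sup>2 / u) s - (szego_sum q q s)\<^sup>2
      = infsum f UNIV * infsum g UNIV - infsum c UNIV * infsum c UNIV"
    by (simp add: szego_sum_def f_def[abs_def] g_def[abs_def] c_def szego_coeff_def[abs_def] power2_eq_square)
  also have "\<dots> = (\<Sum>\<^sub>\<infinity>(n, m)\<in>UNIV \<times> UNIV. c n * c m * ((u / q) powi (n - m) - 1))"
    unfolding eq
    by (subst infsum_add)
      (simp_all only: summable_on_uminus infsum_uminus infsum_product_real f g c add_uminus_conv_diff)
  also have "\<dots> = (\<Sum>\<^sub>\<infinity>d. of_int d * q powi d / (1 - q powi (2 * d)) * ((u / q) powi d - 1)) / s"
    unfolding c_def
    by (rule infsum_szego_coeff_double[where C = "max 1 (1 / s)"])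
      (use q s nz szego_coeff_bound sm in \<open>auto simp: c_def\<close>)
  finally show ?thesis .
qed

section \<open>Second-order behaviour of the telescoped series\<close>

lemma lambert_weight_eq:
  fixes q :: real
  assumes "0 < q"
  shows "of_int d * q powi d / (1 - q powi (2 * d))
    = real (nat \<bar>d\<bar>) * q ^ nat \<bar>d\<bar> / (1 - (q\<^sup>2) ^ nat \<bar>d\<bar>)"
proof (cases d rule: int_cases2)
  case (nonneg k)
  then show ?thesis by (simp add: power_int_mult flip: power_mult)
next
  case (nonpos k)
  \<comment> \<open>When \<open>x * x = 1\<close> both denominators vanish and both quotients are 0
    by convention; this includes \<open>d = 0\<close>.\<close>
  have "x = 0 \<or> - (a * inverse x) / (1 - inverse (x * x)) = a * x / (1 - x * x)" for a x :: real
    by (cases "x * x = 1") (auto simp: divide_simps algebra_simps)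
  from this[of "q ^ k" "real k"] show ?thesis using nonpos assms
    by (auto simp: power_int_minus power_int_mult power2_eq_square power_mult_distrib)
qed

lemma lambert_weight_bound:
  fixes q :: real
  assumes "0 < q" "q < 1"
  shows "0 \<le> of_int d * q powi d / (1 - q powi (2 * d))"
    and "of_int d * q powi d / (1 - q powi (2 * d)) \<le> real (nat \<bar>d\<bar>) * q ^ nat \<bar>d\<bar> / (1 - q\<^sup>2)"
proof -
  have q2: "0 < q\<^sup>2" "q\<^sup>2 < 1"
    using power_strict_mono[of q 1 2] assms by simp_all
  define k where "k = nat \<bar>d\<bar>"
  have "0 \<le> real k * q ^ k / (1 - (q\<^sup>2) ^ k) \<and> real k * q ^ k / (1 - (q\<^sup>2) ^ k) \<le> real k * q ^ k / (1 - q\<^sup>2)"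
  proof (cases "k = 0")
    case False
    then have "(q\<^sup>2) ^ k \<le> q\<^sup>2" using q2 power_decreasing[of 1 k "q\<^sup>2"] by simp
    then show ?thesis using q2 assms
      by (auto intro!: divide_left_mono divide_nonneg_pos mult_pos_pos)
  qed auto
  then show "0 \<le> of_int d * q powi d / (1 - q powi (2 * d))"
    and "of_int d * q powi d / (1 - q powi (2 * d)) \<le> real (nat \<bar>d\<bar>) * q ^ nat \<bar>d\<bar> / (1 - q\<^sup>2)"
    unfolding lambert_weight_eq[OF assms(1)] k_def by blast+
qed

lemma powi_add_inverse:
  fixes v :: real
  assumes "v > 0"
  shows "v powi d + v powi (- d) - 2 = (v ^ nat \<bar>d\<bar> - 1)\<^sup>2 / v ^ nat \<bar>d\<bar>"
  using assms
  by (cases d rule: int_cases2) (simp_all add: power_int_minus power2_eq_square field_simps)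

text \<open>Averaging over \<open>d\<close> and \<open>-d\<close> extracts the factor
  \<open>(v - 1)^2\<close> exactly, since \<open>v^k - 1\<close> is \<open>v - 1\<close> times a
  geometric sum. The remaining terms converge to \<open>a d / 2 * d^2\<close>, with a summable
  majorant.\<close>

lemma tendsto_lambert_second_difference:
  assumes q: "0 < q" "q < 1"
  shows "((\<lambda>v. (\<Sum>\<^sub>\<infinity>d. of_int d * q powi d / (1 - q powi (2 * d)) * (v powi d - 1)) / (v - 1)\<^sup>2)
    \<longlongrightarrow> lambert_cubic q / 2) (at_right 1)"
proof -
  define a where "a d = of_int d * q powi d / (1 - q powi (2 * d))" for d :: int
  define t where "t v d = a d / 2 * (((\<Sum>i<nat \<bar>d\<bar>. v ^ i))\<^sup>2 / v ^ nat \<bar>d\<bar>)" for v :: real and d :: int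
  define \<rho> where "\<rho> = sqrt q"
  have \<rho>: "0 < \<rho>" "\<rho> < 1" "\<rho> * \<rho> = q" using q by (auto simp: \<rho>_def)
  have q2: "0 < q\<^sup>2" "q\<^sup>2 < 1"
    using power_strict_mono[of q 1 2] q by simp_all
  have a_even: "a (- d) = a d" for d
    using lambert_weight_eq[OF q(1), of d] lambert_weight_eq[OF q(1), of "- d"] by (simp add: a_def)
  have a_bound: "0 \<le> a d" "a d \<le> real (nat \<bar>d\<bar>) * q ^ nat \<bar>d\<bar> / (1 - q\<^sup>2)" for d
    using lambert_weight_bound[OF q] by (simp_all add: a_def)
  \<comment> \<open>On the window \<open>1 < v < 1 / sqrt q\<close> half of the decay of
    \<open>q^k\<close> pays for the growth of \<open>v^k\<close>.\<close>
  have qv: "q ^ k * v ^ k \<le> \<rho> ^ k" if "1 < v" "v < 1 / \<rho>" for k v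
  proof -
    have "q * v \<le> \<rho> * \<rho> * (1 / \<rho>)" using that \<rho> q by (intro mult_mono) auto
    also have "\<rho> * \<rho> * (1 / \<rho>) = \<rho>" using \<rho>(1) by simp
    finally have "q * v \<le> \<rho>" .
    then show ?thesis using that q by (simp add: power_mono flip: power_mult_distrib)
  qed
  have half: "(\<Sum>\<^sub>\<infinity>d. a d * (v powi d - 1)) / (v - 1)\<^sup>2 = (\<Sum>\<^sub>\<infinity>d. t v d)"
    if v: "1 < v" "v < 1 / \<rho>" for v
  proof -
    define h where "h d = a d * (v powi d - 1)" for d
    have h: "h summable_on UNIV"
    proof (rule summable_on_int_comparison[OF \<rho>(1,2), where C = "1 / (1 - q\<^sup>2)" and k = 1])
      fix d :: int
      define k where "k = nat \<bar>d\<bar>"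
      have "\<bar>v powi d - 1\<bar> \<le> v ^ k"
      proof (cases d rule: int_cases2)
        case (nonneg n)
        then show ?thesis using v by (simp add: k_def)
      next
        case (nonpos n)
        have "1 \<le> v ^ n" using v by simp
        then have "0 \<le> inverse (v ^ n)" "inverse (v ^ n) \<le> 1" by (auto intro: inverse_le_1_iff[THEN iffD2])
        with \<open>1 \<le> v ^ n\<close> have "\<bar>inverse (v ^ n) - 1\<bar> \<le> v ^ n" by linarith
        then show ?thesis using nonpos by (simp add: k_def power_int_minus)
      qed
      then have "\<bar>h d\<bar> \<le> (real k * q ^ k / (1 - q\<^sup>2)) * v ^ k"
        unfolding h_def abs_mult using a_bound[of d] by (intro mult_mono) (auto simp: k_def)
      also have "\<dots> = real k / (1 - q\<^sup>2) * (q ^ k * v ^ k)" by simp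
      also have "\<dots> \<le> real k / (1 - q\<^sup>2) * \<rho> ^ k"
        using q2 qv[OF v] by (intro mult_left_mono) auto
      finally show "\<bar>h d\<bar> \<le> 1 / (1 - q\<^sup>2) * (real_of_int \<bar>d\<bar> ^ 1 * \<rho> ^ nat \<bar>d\<bar>)"
        by (simp add: k_def)
    qed
    have h_refl: "(\<lambda>d. h (- d)) summable_on UNIV" "(\<Sum>\<^sub>\<infinity>d. h (- d)) = infsum h UNIV"
      using h summable_on_reindex_bij_witness[of UNIV uminus uminus UNIV h "\<lambda>d. h (- d)"]
        infsum_reindex_bij_witness[of UNIV uminus uminus UNIV h "\<lambda>d. h (- d)"]
      by auto
    have "infsum h UNIV = (infsum h UNIV + (\<Sum>\<^sub>\<infinity>d. h (- d))) / 2"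
      using h_refl by simp
    also have "\<dots> = (\<Sum>\<^sub>\<infinity>d. h d + h (- d)) / 2"
      using h h_refl by (simp add: infsum_add)
    also have "\<dots> = (\<Sum>\<^sub>\<infinity>d. t v d * (v - 1)\<^sup>2 * 2) / 2"
    proof -
      have "h d + h (- d) = t v d * (v - 1)\<^sup>2 * 2" for d
      proof -
        have "h d + h (- d) = a d * (v powi d + v powi (- d) - 2)"
          by (simp add: h_def a_even algebra_simps)
        also have "\<dots> = a d * ((v ^ nat \<bar>d\<bar> - 1)\<^sup>2 / v ^ nat \<bar>d\<bar>)"
          using v by (simp only: powi_add_inverse)
        also have "(v ^ nat \<bar>d\<bar> - 1) = (v - 1) * (\<Sum>i<nat \<bar>d\<bar>. v ^ i)"
          by (rule power_diff_1_eq)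
        finally show ?thesis by (simp add: t_def power_mult_distrib mult_ac)
      qed
      then show ?thesis by simp
    qed
    also have "\<dots> = (\<Sum>\<^sub>\<infinity>d. t v d) * (v - 1)\<^sup>2"
      by (simp add: infsum_cmult_left')
    finally show ?thesis using v by (simp add: h_def[abs_def])
  qed
  have ev: "\<forall>\<^sub>F v in at_right 1. 1 < v \<and> v < 1 / \<rho>"
    using \<rho> by (auto simp: eventually_at_right[of 1 "1 / \<rho>"] intro!: exI[of _ "1 / \<rho>"])
  have "((\<lambda>v. \<Sum>\<^sub>\<infinity>d. t v d) \<longlongrightarrow> (\<Sum>\<^sub>\<infinity>d. a d / 2 * (real (nat \<bar>d\<bar>))\<^sup>2)) (at_right 1)"
  proof (rule tendsto_infsum_dominated)
    show "(\<lambda>d. 1 / (2 * (1 - q\<^sup>2)) * (real_of_int \<bar>d\<bar> ^ 3 * \<rho> ^ nat \<bar>d\<bar>)) summable_on UNIV"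
      by (intro summable_on_cmult_right summable_on_int_power_abs \<rho>)
    show "\<forall>\<^sub>F v in at_right 1. \<forall>d\<in>UNIV. norm (t v d) \<le> 1 / (2 * (1 - q\<^sup>2)) * (real_of_int \<bar>d\<bar> ^ 3 * \<rho> ^ nat \<bar>d\<bar>)"
      using ev
    proof (eventually_elim, intro ballI)
      fix v :: real and d :: int assume v: "1 < v \<and> v < 1 / \<rho>"
      define k where "k = nat \<bar>d\<bar>"
      have "(\<Sum>i<k. v ^ i) \<le> (\<Sum>i<k. v ^ k)"
        using v by (intro sum_mono power_increasing) auto
      then have "(\<Sum>i<k. v ^ i)\<^sup>2 \<le> (real k * v ^ k)\<^sup>2"
        using v by (intro power_mono) (auto intro: sum_nonneg)
      then have "(\<Sum>i<k. v ^ i)\<^sup>2 / v ^ k \<le> (real k)\<^sup>2 * v ^ k"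
        using v by (simp add: divide_simps power2_eq_square mult_ac)
      moreover have "a d / 2 \<le> real k * q ^ k / (1 - q\<^sup>2) / 2"
        unfolding k_def by (intro divide_right_mono a_bound) simp
      ultimately have "t v d \<le> real k * q ^ k / (1 - q\<^sup>2) / 2 * ((real k)\<^sup>2 * v ^ k)"
        unfolding t_def k_def[symmetric] using a_bound(1)[of d] v q q2
        by (intro mult_mono) auto
      also have "\<dots> = real k ^ 3 / (2 * (1 - q\<^sup>2)) * (q ^ k * v ^ k)"
        by (simp add: power2_eq_square power3_eq_cube mult_ac)
      also have "\<dots> \<le> real k ^ 3 / (2 * (1 - q\<^sup>2)) * \<rho> ^ k"
        using q2 qv v by (intro mult_left_mono) auto
      finally have "t v d \<le> 1 / (2 * (1 - q\<^sup>2)) * (real_of_int \<bar>d\<bar> ^ 3 * \<rho> ^ nat \<bar>d\<bar>)"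
        by (simp add: k_def)
      moreover have "t v d \<ge> 0"
        unfolding t_def using a_bound(1)[of d] v by (intro mult_nonneg_nonneg divide_nonneg_nonneg) auto
      ultimately show "norm (t v d) \<le> 1 / (2 * (1 - q\<^sup>2)) * (real_of_int \<bar>d\<bar> ^ 3 * \<rho> ^ nat \<bar>d\<bar>)"
        by simp
    qed
    show "((\<lambda>v. t v d) \<longlongrightarrow> a d / 2 * (real (nat \<bar>d\<bar>))\<^sup>2) (at_right 1)" for d
    proof -
      have "((\<lambda>v. t v d) \<longlongrightarrow> a d / 2 * ((\<Sum>i<nat \<bar>d\<bar>. 1 ^ i)\<^sup>2 / 1 ^ nat \<bar>d\<bar>)) (at_right 1)"
        unfolding t_def by (intro tendsto_intros) auto
      then show ?thesis by simp
    qed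
  qed
  also have "(\<Sum>\<^sub>\<infinity>d. a d / 2 * (real (nat \<bar>d\<bar>))\<^sup>2) = lambert_cubic q / 2"
  proof -
    have "a d / 2 * (real (nat \<bar>d\<bar>))\<^sup>2 = of_int d ^ 3 * q powi d / (1 - q powi (2 * d)) * (1 / 2)" for d
      by (simp add: a_def power2_eq_square power3_eq_cube abs_if)
    then have "(\<Sum>\<^sub>\<infinity>d. a d / 2 * (real (nat \<bar>d\<bar>))\<^sup>2)
        = (\<Sum>\<^sub>\<infinity>d. of_int d ^ 3 * q powi d / (1 - q powi (2 * d)) * (1 / 2))"
      by (simp only:)
    also have "\<dots> = lambert_cubic q * (1 / 2)"
      unfolding lambert_cubic_def by (rule infsum_cmult_left')
    finally show ?thesis by simp
  qed
  finally have "((\<lambda>v. \<Sum>\<^sub>\<infinity>d. t v d) \<longlongrightarrow> lambert_cubic q / 2) (at_right 1)" .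
  moreover have "\<forall>\<^sub>F v in at_right 1. (\<Sum>\<^sub>\<infinity>d. t v d) = (\<Sum>\<^sub>\<infinity>d. a d * (v powi d - 1)) / (v - 1)\<^sup>2"
    using ev by eventually_elim (simp add: half)
  ultimately show ?thesis
    unfolding a_def by (rule Lim_transform_eventually)
qed

section \<open>Partial fractions of theta quotients\<close>

text \<open>Lagrange interpolation: after clearing denominators, the difference of the two sides is
  a polynomial in \<open>s\<close> of degree below \<open>card I\<close> that vanishes at the
  \<open>card I\<close> distinct points \<open>- 1 / y i\<close>.\<close>

lemma partial_fractions:
  fixes y :: "'i \<Rightarrow> real" and z :: "'k \<Rightarrow> real"
  assumes fin: "finite I" "finite K" and card: "card K < card I" and inj: "inj_on y I"
    and y0: "\<And>i. i \<in> I \<Longrightarrow> y i \<noteq> 0" and s: "\<And>i. i \<in> I \<Longrightarrow> 1 + s * y i \<noteq> 0"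
  shows "(\<Prod>k\<in>K. 1 + s * z k) / (\<Prod>i\<in>I. 1 + s * y i)
    = (\<Sum>i\<in>I. (\<Prod>k\<in>K. 1 - z k / y i) / (\<Prod>j\<in>I - {i}. 1 - y j / y i) / (1 + s * y i))"
proof -
  define A where "A i = (\<Prod>k\<in>K. 1 - z k / y i) / (\<Prod>j\<in>I - {i}. 1 - y j / y i)" for i
  define p where "p = (\<Prod>k\<in>K. [:1, z k:]) - (\<Sum>i\<in>I. smult (A i) (\<Prod>j\<in>I - {i}. [:1, y j:]))"
  have deg: "degree (\<Prod>k\<in>J. [:1, f k:]) \<le> card J" if "finite J" for J and f :: "'b \<Rightarrow> real"
  proof -
    have "degree (\<Prod>k\<in>J. [:1, f k:]) \<le> sum (degree \<circ> (\<lambda>k. [:1, f k:])) J"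
      using that by (rule degree_prod_sum_le)
    also have "\<dots> \<le> (\<Sum>k\<in>J. 1)" by (intro sum_mono) simp
    finally show ?thesis by simp
  qed
  have "p = 0"
  proof (rule ccontr)
    assume "p \<noteq> 0"
    have "degree p < card I" unfolding p_def
    proof (rule degree_diff_less)
      show "degree (\<Prod>k\<in>K. [:1, z k:]) < card I"
        using deg[OF fin(2)] card by (rule le_less_trans)
      have "degree (\<Sum>i\<in>I. smult (A i) (\<Prod>j\<in>I - {i}. [:1, y j:])) \<le> card I - 1"
      proof (rule degree_sum_le[OF fin(1)])
        fix i assume "i \<in> I"
        have "degree (smult (A i) (\<Prod>j\<in>I - {i}. [:1, y j:])) \<le> degree (\<Prod>j\<in>I - {i}. [:1, y j:])"
          by (rule degree_smult_le)
        also have "\<dots> \<le> card (I - {i})" using fin by (intro deg) simp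
        also have "\<dots> = card I - 1" using \<open>i \<in> I\<close> fin by simp
        finally show "degree (smult (A i) (\<Prod>j\<in>I - {i}. [:1, y j:])) \<le> card I - 1" .
      qed
      then show "degree (\<Sum>i\<in>I. smult (A i) (\<Prod>j\<in>I - {i}. [:1, y j:])) < card I"
        using card by linarith
    qed
    moreover have "(\<lambda>i. - 1 / y i) ` I \<subseteq> {x. poly p x = 0}"
    proof clarify
      fix i assume i: "i \<in> I"
      have ne: "(\<Prod>j\<in>I - {i}. 1 - y j / y i) \<noteq> 0"
        using fin i inj y0 by (auto simp: inj_on_def field_simps)
      have other: "(\<Prod>j\<in>I - {k}. 1 - y j / y i) = 0" if "k \<in> I" "k \<noteq> i" for k
        using fin i that y0[OF i] by (intro prod_zero) (auto intro!: bexI[of _ i])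
      have "poly p (- 1 / y i) = (\<Prod>k\<in>K. 1 - z k / y i) - (\<Sum>k\<in>I. A k * (\<Prod>j\<in>I - {k}. 1 - y j / y i))"
        by (simp add: p_def poly_prod poly_sum)
      also have "(\<Sum>k\<in>I. A k * (\<Prod>j\<in>I - {k}. 1 - y j / y i))
          = (\<Sum>k\<in>I. if k = i then A i * (\<Prod>j\<in>I - {i}. 1 - y j / y i) else 0)"
        by (intro sum.cong) (auto simp: other)
      also have "\<dots> = (\<Prod>k\<in>K. 1 - z k / y i)"
        using fin i ne by (simp add: A_def)
      finally show "poly p (- 1 / y i) = 0" by simp
    qed
    then have "card ((\<lambda>i. - 1 / y i) ` I) \<le> card {x. poly p x = 0}"
      using poly_roots_finite[OF \<open>p \<noteq> 0\<close>] by (intro card_mono)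
    moreover have "inj_on (\<lambda>i. - 1 / y i) I"
      using inj y0 by (auto simp: inj_on_def)
    ultimately show False
      using card_poly_roots_bound[OF \<open>p \<noteq> 0\<close>] by (simp add: card_image)
  qed
  then have "poly p s = 0" by simp
  then have "(\<Prod>k\<in>K. 1 + s * z k) = (\<Sum>i\<in>I. A i * (\<Prod>j\<in>I - {i}. 1 + s * y j))"
    by (simp add: p_def poly_prod poly_sum)
  also have "\<dots> = (\<Sum>i\<in>I. A i / (1 + s * y i) * (\<Prod>j\<in>I. 1 + s * y j))"
    using s fin by (intro sum.cong) (simp_all add: prod.remove[of I])
  also have "\<dots> = (\<Sum>i\<in>I. A i / (1 + s * y i)) * (\<Prod>j\<in>I. 1 + s * y j)"
    by (rule sum_distrib_right[symmetric])
  finally show ?thesis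
    using s fin by (simp add: A_def)
qed

lemma prod_int_up: "(\<Prod>k\<in>{a..<b}. f k) = (\<Prod>i<nat (b - a). f (a + int i))" for a b :: int
  by (rule prod.reindex_bij_witness[of _ "\<lambda>i. a + int i" "\<lambda>k. nat (k - a)"]) auto

lemma prod_int_down: "(\<Prod>k\<in>{a..<b}. f k) = (\<Prod>i<nat (b - a). f (b - 1 - int i))" for a b :: int
  by (rule prod.reindex_bij_witness[of _ "\<lambda>i. b - 1 - int i" "\<lambda>k. nat (b - 1 - k)"]) auto

text \<open>In Pochhammer notation this is \<open>(q; q^2)_m / (q^2; q^2)_m\<close>, the
  contribution to a residue of the \<open>m\<close> index pairs on one side of the pole.\<close>

definition theta_weight :: "real \<Rightarrow> nat \<Rightarrow> real" where
  "theta_weight q m = (\<Prod>i<m. 1 - q * q ^ (2 * i)) / (\<Prod>i<m. 1 - q\<^sup>2 * q ^ (2 * i))"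

lemma powi_odd: "q powi (2 * int i + 1) = q * q ^ (2 * i)" for q :: real
proof -
  have "2 * int i + 1 = int (2 * i + 1)" by simp
  then show ?thesis by (simp only: power_int_of_nat) simp
qed

lemma powi_even: "q powi (2 * int i + 2) = q\<^sup>2 * q ^ (2 * i)" for q :: real
proof -
  have "2 * int i + 2 = int (2 * i + 2)" by simp
  then show ?thesis by (simp only: power_int_of_nat) (simp add: power_add power2_eq_square)
qed

text \<open>Clearing negative powers costs one factor \<open>q\<close> per quotient. The resulting
  \<open>q ^ M\<close> tends to 0, so it has to be cancelled before any passage to the
  limit.\<close>

lemma prod_negative_ratio:
  fixes q s :: real
  assumes "q > 0"
  shows "(\<Prod>i<M. 1 + s * q powi (- (2 * int i + 1))) / (\<Prod>i<M. 1 + s * q powi (- (2 * int i + 2)))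
    = q ^ M * ((\<Prod>i<M. s + q * q ^ (2 * i)) / (\<Prod>i<M. s + q\<^sup>2 * q ^ (2 * i)))"
proof -
  have *: "(1 + s * inverse a) / (1 + s * inverse (q * a)) = q * ((s + a) / (s + q * a))" if "a > 0" for a
    using that assms by (simp add: divide_simps) (auto simp: algebra_simps)
  have eq: "(1 + s * q powi (- (2 * int i + 1))) / (1 + s * q powi (- (2 * int i + 2)))
      = q * ((s + q * q ^ (2 * i)) / (s + q\<^sup>2 * q ^ (2 * i)))" for i
    using *[of "q * q ^ (2 * i)"] assms
    unfolding power_int_minus powi_odd powi_even by (simp add: power2_eq_square mult_ac)
  show ?thesis
    unfolding prod_dividef[symmetric] eq prod.distrib by simp
qed

text \<open>After division by \<open>q powi (2 * n)\<close> the factors depend only on the distance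
  to \<open>n\<close>, so both products are split at \<open>n\<close>. The indices below
  \<open>n\<close> carry negative exponents and produce the power \<open>q^(N+n)\<close>; those
  above produce no power.\<close>

lemma theta_weight_residue:
  assumes q: "0 < q" and n: "- int N \<le> n" "n \<le> int N"
  shows "(\<Prod>k\<in>{- int N..<int N}. 1 - q powi (2 * k + 1) / q powi (2 * n))
      / (\<Prod>j\<in>{- int N..int N} - {n}. 1 - q powi (2 * j) / q powi (2 * n))
    = q ^ N * (q powi n * theta_weight q (nat (int N - n)) * theta_weight q (nat (int N + n)))"
proof -
  define f where "f k = 1 - q powi (2 * k + 1) / q powi (2 * n)" for k
  define g where "g k = 1 - q powi (2 * k) / q powi (2 * n)" for k
  have f: "f k = 1 - q powi (2 * (k - n) + 1)" and g: "g k = 1 - q powi (2 * (k - n))" for k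
    using q by (simp_all add: f_def g_def power_int_diff[symmetric] algebra_simps)
  have K: "{- int N..<int N} = {- int N..<n} \<union> {n..<int N}" and I: "{- int N..int N} - {n} = {- int N..<n} \<union> {n + 1..<int N + 1}"
    using n by auto
  have down: "(\<Prod>k\<in>{- int N..<n}. f k) / (\<Prod>k\<in>{- int N..<n}. g k) = q powi (int N + n) * theta_weight q (nat (int N + n))"
  proof -
    have "f (n - 1 - int i) = 1 + (-1) * q powi (- (2 * int i + 1))"
      "g (n - 1 - int i) = 1 + (-1) * q powi (- (2 * int i + 2))" for i
      by (simp_all add: f g algebra_simps)
    \<comment> \<open>At \<open>s = -1\<close> the factors come out with reversed sign; there are
      \<open>M\<close> of them above and below, so the signs cancel.\<close>
    moreover have "(\<Prod>i<M. a i - 1) / (\<Prod>i<M. b i - 1) = (\<Prod>i<M. 1 - a i) / (\<Prod>i<M. 1 - b i)"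
      for M and a b :: "nat \<Rightarrow> real"
      unfolding prod_dividef[symmetric] by (intro prod.cong refl) (metis minus_diff_eq minus_divide_divide)
    ultimately show ?thesis
      unfolding prod_int_down prod_negative_ratio[OF q, of "-1"] theta_weight_def
      using prod_negative_ratio[OF q, of "-1" "nat (n + int N)"] n
      by (simp add: add.commute power_int_def)
  qed
  have up: "(\<Prod>k\<in>{n..<int N}. f k) / (\<Prod>k\<in>{n + 1..<int N + 1}. g k) = theta_weight q (nat (int N - n))"
  proof -
    have "f (n + int i) = 1 - q * q ^ (2 * i)" "g (n + 1 + int i) = 1 - q\<^sup>2 * q ^ (2 * i)" for i
      using powi_odd[of q i] powi_even[of q i] by (simp_all add: f g algebra_simps)
    then show ?thesis by (simp add: prod_int_up theta_weight_def)
  qed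
  have "(\<Prod>k\<in>{- int N..<int N}. f k) / (\<Prod>k\<in>{- int N..int N} - {n}. g k)
      = ((\<Prod>k\<in>{- int N..<n}. f k) / (\<Prod>k\<in>{- int N..<n}. g k))
        * ((\<Prod>k\<in>{n..<int N}. f k) / (\<Prod>k\<in>{n + 1..<int N + 1}. g k))"
    unfolding K I by (subst (1 2) prod.union_disjoint) auto
  also have "\<dots> = q ^ N * (q powi n * theta_weight q (nat (int N - n)) * theta_weight q (nat (int N + n)))"
    unfolding down up using q by (simp add: power_int_add)
  finally show ?thesis by (simp add: f_def g_def)
qed

lemma inj_on_powi_even:
  fixes q :: real
  assumes "0 < q" "q < 1"
  shows "inj_on (\<lambda>n. q powi (2 * n)) A"
proof (rule inj_onI)
  fix m n assume "q powi (2 * m) = q powi (2 * n)"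
  then show "m = n"
    using power_int_strict_decreasing[of "2 * m" "2 * n" q] power_int_strict_decreasing[of "2 * n" "2 * m" q] assms
    by (cases m n rule: linorder_cases) auto
qed

text \<open>The symmetric truncation of the theta quotient has \<open>2N\<close> odd exponents above
  and \<open>2N + 1\<close> even exponents below, hence is a proper fraction in \<open>s\<close>.
  Product and residues carry the same factor \<open>q ^ N\<close>, and removing it leaves an
  identity whose two sides converge.\<close>

lemma finite_szego_sum:
  assumes q: "0 < q" "q < 1" and s: "s \<noteq> 0"
    and nz: "\<And>n. 1 + s * q powi (2 * n) \<noteq> 0"
  shows "(\<Sum>n\<in>{- int N..int N}. q powi n * theta_weight q (nat (int N - n)) * theta_weight q (nat (int N + n))
      / (1 + s * q powi (2 * n)))
    = (\<Prod>i<N. s + q * q ^ (2 * i)) / (\<Prod>i<N. s + q\<^sup>2 * q ^ (2 * i))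
      * ((\<Prod>i<N. 1 + s * q * q ^ (2 * i)) / (\<Prod>i<Suc N. 1 + s * q ^ (2 * i)))"
proof -
  have "(\<Prod>k\<in>{- int N..<int N}. 1 + s * q powi (2 * k + 1)) / (\<Prod>i\<in>{- int N..int N}. 1 + s * q powi (2 * i))
    = (\<Sum>n\<in>{- int N..int N}. (\<Prod>k\<in>{- int N..<int N}. 1 - q powi (2 * k + 1) / q powi (2 * n))
      / (\<Prod>j\<in>{- int N..int N} - {n}. 1 - q powi (2 * j) / q powi (2 * n)) / (1 + s * q powi (2 * n)))"
    using q nz inj_on_powi_even[OF q] by (intro partial_fractions) auto
  also have "\<dots> = q ^ N * (\<Sum>n\<in>{- int N..int N}. q powi n * theta_weight q (nat (int N - n)) * theta_weight q (nat (int N + n))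
      / (1 + s * q powi (2 * n)))"
    unfolding sum_distrib_left using q by (intro sum.cong refl) (simp add: theta_weight_residue)
  also have "(\<Prod>k\<in>{- int N..<int N}. 1 + s * q powi (2 * k + 1)) / (\<Prod>i\<in>{- int N..int N}. 1 + s * q powi (2 * i))
    = ((\<Prod>k\<in>{- int N..<0}. 1 + s * q powi (2 * k + 1)) / (\<Prod>i\<in>{- int N..<0}. 1 + s * q powi (2 * i)))
      * ((\<Prod>k\<in>{0..<int N}. 1 + s * q powi (2 * k + 1)) / (\<Prod>i\<in>{0..<int N + 1}. 1 + s * q powi (2 * i)))"
  proof -
    have "{- int N..<int N} = {- int N..<0} \<union> {0..<int N}" "{- int N..int N} = {- int N..<0} \<union> {0..<int N + 1}"
      by auto
    then show ?thesis by (simp add: prod.union_disjoint)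
  qed
  also have "(\<Prod>k\<in>{- int N..<0}. 1 + s * q powi (2 * k + 1)) / (\<Prod>i\<in>{- int N..<0}. 1 + s * q powi (2 * i))
      = q ^ N * ((\<Prod>i<N. s + q * q ^ (2 * i)) / (\<Prod>i<N. s + q\<^sup>2 * q ^ (2 * i)))"
    unfolding prod_int_down using prod_negative_ratio[OF q(1), of s N] by (simp add: algebra_simps)
  also have "(\<Prod>k\<in>{0..<int N}. 1 + s * q powi (2 * k + 1)) / (\<Prod>i\<in>{0..<int N + 1}. 1 + s * q powi (2 * i))
      = (\<Prod>i<N. 1 + s * q * q ^ (2 * i)) / (\<Prod>i<Suc N. 1 + s * q ^ (2 * i))"
    by (simp add: prod_int_up powi_odd nat_add_distrib power_int_mult mult.assoc del: prod.lessThan_Suc flip: power_mult)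
  finally have "q ^ N * ((\<Prod>i<N. s + q * q ^ (2 * i)) / (\<Prod>i<N. s + q\<^sup>2 * q ^ (2 * i)))
      * ((\<Prod>i<N. 1 + s * q * q ^ (2 * i)) / (\<Prod>i<Suc N. 1 + s * q ^ (2 * i)))
    = q ^ N * (\<Sum>n\<in>{- int N..int N}. q powi n * theta_weight q (nat (int N - n)) * theta_weight q (nat (int N + n))
      / (1 + s * q powi (2 * n)))" .
  moreover have "Z = X * Y" if "q ^ N * X * Y = q ^ N * Z" for X Y Z
    using that q by (simp add: mult.assoc)
  ultimately show ?thesis by blast
qed

section \<open>Infinite products with base \<open>q^2\<close> and the limit of the
  truncations\<close>

definition qpoch :: "real \<Rightarrow> real \<Rightarrow> real" where
  "qpoch q z = (\<Prod>n. 1 - z * q ^ (2 * n))"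

lemma summable_q_powers:
  fixes q :: real
  assumes "0 < q" "q < 1"
  shows "summable (\<lambda>n. q ^ (2 * n))"
proof -
  have "q\<^sup>2 < 1" using power_strict_mono[of q 1 2] assms by simp
  then have "summable (\<lambda>n. (q\<^sup>2) ^ n)" by (intro summable_geometric) simp
  then show ?thesis by (simp add: power_mult)
qed

lemma convergent_prod_qpoch:
  fixes q z :: real
  assumes "0 < q" "q < 1"
  shows "convergent_prod (\<lambda>n. 1 - z * q ^ (2 * n))"
proof -
  have "summable (\<lambda>n. norm (- z * q ^ (2 * n)))"
    using summable_mult[OF summable_q_powers[OF assms], of "\<bar>z\<bar>"] assms by (simp add: abs_mult)
  then have "abs_convergent_prod (\<lambda>n. 1 + - z * q ^ (2 * n))"
    by (intro summable_imp_abs_convergent_prod) simp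
  then show ?thesis
    using abs_convergent_prod_imp_convergent_prod by fastforce
qed

lemma qpoch_LIMSEQ:
  assumes "0 < q" "q < 1"
  shows "(\<lambda>N. \<Prod>i<N. 1 - z * q ^ (2 * i)) \<longlonglongrightarrow> qpoch q z"
  using convergent_prod_LIMSEQ[OF convergent_prod_qpoch[OF assms, of z]]
  by (simp add: qpoch_def LIMSEQ_lessThan_iff_atMost)

lemma qpoch_Suc:
  assumes "0 < q" "q < 1"
  shows "qpoch q z = (1 - z) * qpoch q (q\<^sup>2 * z)"
proof (rule LIMSEQ_unique)
  show "(\<lambda>N. \<Prod>i<Suc N. 1 - z * q ^ (2 * i)) \<longlonglongrightarrow> qpoch q z"
    by (rule LIMSEQ_Suc[OF qpoch_LIMSEQ[OF assms]])
  have "(\<lambda>N. (1 - z) * (\<Prod>i<N. 1 - q\<^sup>2 * z * q ^ (2 * i))) \<longlonglongrightarrow> (1 - z) * qpoch q (q\<^sup>2 * z)"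
    by (intro tendsto_mult tendsto_const qpoch_LIMSEQ assms)
  then show "(\<lambda>N. \<Prod>i<Suc N. 1 - z * q ^ (2 * i)) \<longlonglongrightarrow> (1 - z) * qpoch q (q\<^sup>2 * z)"
    by (simp add: prod.lessThan_Suc_shift power_add power2_eq_square mult_ac del: prod.lessThan_Suc)
qed

lemma qpoch_pos:
  assumes "0 < q" "q < 1" "z < 1"
  shows "qpoch q z > 0"
proof -
  have "0 < 1 - z * q ^ (2 * n)" for n
  proof (cases "z \<le> 0")
    case True
    then have "z * q ^ (2 * n) \<le> 0" using assms by (simp add: mult_le_0_iff)
    then show ?thesis by linarith
  next
    case False
    then have "z * q ^ (2 * n) \<le> z * 1" using assms by (intro mult_left_mono power_le_one) auto
    then show ?thesis using assms by linarith
  qed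
  then show ?thesis
    unfolding qpoch_def using convergent_prod_qpoch[OF assms(1,2), of z] by (intro less_0_prodinf)
qed

lemma theta_eq_qpoch:
  fixes q z :: real
  assumes "0 < q" "q < 1"
  shows "theta q z = qpoch q z * qpoch q (q\<^sup>2 / z)"
  unfolding theta_def qpoch_def
  by (subst prodinf_mult[OF convergent_prod_qpoch[OF assms] convergent_prod_qpoch[OF assms]])
    (simp add: power_add power2_eq_square mult_ac)

lemma q_zero_eq_qpoch: "q_zero q = qpoch q (q\<^sup>2)"
  by (simp add: q_zero_def qpoch_def power_add power2_eq_square mult_ac)

text \<open>The reciprocal is Gauss's product for \<open>\<psi>(q)\<close>, the sum of
  \<open>q^(n(n+1)/2)\<close> over \<open>n \<ge> 0\<close>; the square is
  \<open>theta(q) / q_0^2\<close>.\<close>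

definition theta_weight_lim :: "real \<Rightarrow> real" where
  "theta_weight_lim q = qpoch q q / qpoch q (q\<^sup>2)"

lemma theta_weight_lim_pos:
  assumes "0 < q" "q < 1"
  shows "theta_weight_lim q > 0"
proof -
  have "q\<^sup>2 < 1" using power_strict_mono[of q 1 2] assms by simp
  then show ?thesis using assms by (auto simp: theta_weight_lim_def intro!: divide_pos_pos qpoch_pos)
qed

lemma theta_weight_LIMSEQ:
  assumes "0 < q" "q < 1"
  shows "theta_weight q \<longlonglongrightarrow> theta_weight_lim q"
proof -
  have "q\<^sup>2 < 1" using power_strict_mono[of q 1 2] assms by simp
  then have "qpoch q (q\<^sup>2) \<noteq> 0" using qpoch_pos[OF assms, of "q\<^sup>2"] by simp
  then show ?thesis
    unfolding theta_weight_def theta_weight_lim_def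
    by (intro tendsto_divide qpoch_LIMSEQ assms)
qed

text \<open>Extended by 0 outside the window, the sums become series over all integers. The weights
  converge, hence are bounded by some \<open>B\<close>, and \<open>B * B\<close> times the absolute
  value of \<open>b n\<close> is a majorant; for fixed \<open>n\<close> both \<open>N - n\<close>
  and \<open>N + n\<close> tend to infinity.\<close>

lemma theta_weight_sum_LIMSEQ:
  assumes q: "0 < q" "q < 1" and b: "b summable_on UNIV"
  shows "(\<lambda>N. \<Sum>n\<in>{- int N..int N}. b n * (theta_weight q (nat (int N - n)) * theta_weight q (nat (int N + n))))
    \<longlonglongrightarrow> (theta_weight_lim q)\<^sup>2 * infsum b UNIV"
proof -
  define w where "w = theta_weight q"
  define f where "f N n = (if n \<in> {- int N..int N} then b n * (w (nat (int N - n)) * w (nat (int N + n))) else 0)" for N n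
  have wlim: "w \<longlonglongrightarrow> theta_weight_lim q" using theta_weight_LIMSEQ[OF q] by (simp add: w_def)
  then have "Bseq w" by (intro convergent_imp_Bseq) (auto simp: convergent_def)
  then obtain B where B: "0 < B" "\<And>m. norm (w m) \<le> B" by (auto elim: BseqE)
  have "(\<lambda>N. infsum (f N) UNIV) \<longlonglongrightarrow> (\<Sum>\<^sub>\<infinity>n. b n * (theta_weight_lim q * theta_weight_lim q))"
  proof (rule tendsto_infsum_dominated)
    have "(\<lambda>n. norm (b n)) summable_on UNIV"
      using b summable_on_iff_abs_summable_on_real by blast
    then show "(\<lambda>n. norm (b n) * (B * B)) summable_on UNIV"
      by (rule summable_on_cmult_left)
    have "norm (f N n) \<le> norm (b n) * (B * B)" for N n
      using B by (auto simp: f_def abs_mult intro!: mult_left_mono mult_mono)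
    then show "\<forall>\<^sub>F N in sequentially. \<forall>n\<in>UNIV. norm (f N n) \<le> norm (b n) * (B * B)"
      by simp
    show "(\<lambda>N. f N n) \<longlonglongrightarrow> b n * (theta_weight_lim q * theta_weight_lim q)" for n
    proof (rule Lim_transform_eventually)
      have "filterlim (\<lambda>N. nat (int N + d)) at_top sequentially" for d
        unfolding filterlim_at_top
      proof
        fix Z show "\<forall>\<^sub>F N in sequentially. Z \<le> nat (int N + d)"
          by (rule eventually_sequentiallyI[of "nat (int Z + \<bar>d\<bar>)"]) linarith
      qed
      from this[of "- n"] this[of n] show "(\<lambda>N. b n * (w (nat (int N - n)) * w (nat (int N + n)))) \<longlonglongrightarrow> b n * (theta_weight_lim q * theta_weight_lim q)"
        by (intro tendsto_intros filterlim_compose[OF wlim]) simp_all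
      show "\<forall>\<^sub>F N in sequentially. b n * (w (nat (int N - n)) * w (nat (int N + n))) = f N n"
        by (rule eventually_sequentiallyI[of "nat \<bar>n\<bar>"]) (auto simp: f_def)
    qed
  qed
  moreover have "infsum (f N) UNIV = (\<Sum>n\<in>{- int N..int N}. b n * (w (nat (int N - n)) * w (nat (int N + n))))" for N
  proof -
    have "infsum (f N) UNIV = infsum (f N) {- int N..int N}"
      by (intro infsum_cong_neutral) (auto simp: f_def)
    then show ?thesis by (simp add: f_def)
  qed
  moreover have "(\<Sum>\<^sub>\<infinity>n. b n * (theta_weight_lim q * theta_weight_lim q)) = infsum b UNIV * (theta_weight_lim q * theta_weight_lim q)"
    by (rule infsum_cmult_left')
  ultimately show ?thesis by (simp add: w_def power2_eq_square mult.commute)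
qed

text \<open>Both sides are limits of the same truncated partial fraction expansion. As
  \<open>w^2 = theta(q) / q_0^2\<close>, this is the theta formula for the kernel at
  \<open>z * cnj w = q\<close>.\<close>

lemma szego_sum_q:
  assumes q: "0 < q" "q < 1" and s: "s > 0"
  shows "(theta_weight_lim q)\<^sup>2 * szego_sum q q s = theta q (- (q * s)) / theta q (- s)"
proof (rule LIMSEQ_unique)
  define P where "P z N = (\<Prod>i<N. 1 - z * q ^ (2 * i))" for z and N :: nat
  have P: "P z \<longlonglongrightarrow> qpoch q z" for z unfolding P_def by (rule qpoch_LIMSEQ[OF q])
  have nz: "1 + s * q powi (2 * n) \<noteq> 0" for n
    using s q by (metis add_pos_pos less_irrefl mult_pos_pos zero_less_one zero_less_power_int)
  have q2: "q\<^sup>2 < q" using q by (simp add: power2_eq_square)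
  have b: "(\<lambda>n. q powi n / (1 + s * q powi (2 * n))) summable_on UNIV"
    using q s q2 by (intro summable_on_szego_term)
  have "(\<lambda>N. (P (- q / s) N / P (- q\<^sup>2 / s) N) * (P (- (q * s)) N / P (- s) (Suc N)))
    \<longlonglongrightarrow> (qpoch q (- q / s) / qpoch q (- q\<^sup>2 / s)) * (qpoch q (- (q * s)) / qpoch q (- s))"
  proof (intro tendsto_mult tendsto_divide P LIMSEQ_Suc[OF P])
    have "q\<^sup>2 / s \<ge> 0" using s by simp
    then have "- q\<^sup>2 / s < 1" by simp
    then show "qpoch q (- q\<^sup>2 / s) \<noteq> 0" using qpoch_pos[OF q] by (metis less_irrefl)
    show "qpoch q (- s) \<noteq> 0" using qpoch_pos[OF q, of "- s"] s by simp
  qed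
  also have "(qpoch q (- q / s) / qpoch q (- q\<^sup>2 / s)) * (qpoch q (- (q * s)) / qpoch q (- s))
      = theta q (- (q * s)) / theta q (- s)"
    using q s by (simp add: theta_eq_qpoch power2_eq_square mult_ac)
  also have "(\<lambda>N. (P (- q / s) N / P (- q\<^sup>2 / s) N) * (P (- (q * s)) N / P (- s) (Suc N)))
    = (\<lambda>N. \<Sum>n\<in>{- int N..int N}. q powi n / (1 + s * q powi (2 * n))
        * (theta_weight q (nat (int N - n)) * theta_weight q (nat (int N + n))))"
  proof
    fix N
    \<comment> \<open>Factors \<open>s + z * q^(2i)\<close> are normalised to Pochhammer form; the
      powers \<open>s ^ N\<close> above and below then cancel.\<close>
    have scale: "(\<Prod>i<N. s + z * q ^ (2 * i)) = s ^ N * P (- z / s) N" for z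
    proof -
      have "s + z * q ^ (2 * i) = s * (1 - (- z / s) * q ^ (2 * i))" for i
        using s by (simp add: field_simps)
      then show ?thesis by (simp add: P_def prod.distrib)
    qed
    have "(P (- q / s) N / P (- q\<^sup>2 / s) N) * (P (- (q * s)) N / P (- s) (Suc N))
      = (\<Prod>i<N. s + q * q ^ (2 * i)) / (\<Prod>i<N. s + q\<^sup>2 * q ^ (2 * i))
      * ((\<Prod>i<N. 1 + s * q * q ^ (2 * i)) / (\<Prod>i<Suc N. 1 + s * q ^ (2 * i)))"
      unfolding scale using s by (simp add: P_def mult_ac)
    also have "\<dots> = (\<Sum>n\<in>{- int N..int N}. q powi n * theta_weight q (nat (int N - n)) * theta_weight q (nat (int N + n))
      / (1 + s * q powi (2 * n)))"
      using finite_szego_sum[OF q _ nz] s by simp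
    finally show "(P (- q / s) N / P (- q\<^sup>2 / s) N) * (P (- (q * s)) N / P (- s) (Suc N))
      = (\<Sum>n\<in>{- int N..int N}. q powi n / (1 + s * q powi (2 * n))
        * (theta_weight q (nat (int N - n)) * theta_weight q (nat (int N + n))))"
      by (simp add: mult_ac)
  qed
  finally show "(\<lambda>N. \<Sum>n\<in>{- int N..int N}. q powi n / (1 + s * q powi (2 * n))
        * (theta_weight q (nat (int N - n)) * theta_weight q (nat (int N + n))))
    \<longlonglongrightarrow> theta q (- (q * s)) / theta q (- s)" .
  show "(\<lambda>N. \<Sum>n\<in>{- int N..int N}. q powi n / (1 + s * q powi (2 * n))
        * (theta_weight q (nat (int N - n)) * theta_weight q (nat (int N + n))))
    \<longlonglongrightarrow> (theta_weight_lim q)\<^sup>2 * szego_sum q q s"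
    unfolding szego_sum_def by (rule theta_weight_sum_LIMSEQ[OF q b])
qed

section \<open>The cubic Lambert series\<close>

text \<open>The pairs \<open>k + 1\<close>, \<open>- k\<close> are the orbits of
  \<open>n \<mapsto> 1 - n\<close>, the reflection under which the coefficients at
  \<open>s = - 1 / q\<close> are odd.\<close>

lemma infsum_int_pair:
  fixes f :: "int \<Rightarrow> real"
  assumes "f summable_on UNIV"
  shows "(\<lambda>k. f (int k + 1) + f (- int k)) summable_on UNIV"
    and "infsum f UNIV = (\<Sum>\<^sub>\<infinity>k. f (int k + 1) + f (- int k))"
proof -
  have un: "range (\<lambda>k. int k + 1) \<union> range (\<lambda>k. - int k) = UNIV"
  proof -
    have "x \<in> range (\<lambda>k. int k + 1) \<union> range (\<lambda>k. - int k)" for x :: int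
    proof (cases "x > 0")
      case True
      then have "x = int (nat (x - 1)) + 1" by simp
      then show ?thesis by blast
    next
      case False
      then have "x = - int (nat (- x))" by simp
      then show ?thesis by blast
    qed
    then show ?thesis by blast
  qed
  have disj: "range (\<lambda>k. int k + 1) \<inter> range (\<lambda>k. - int k) = {}" by auto
  have inj: "inj (\<lambda>k. int k + 1)" "inj (\<lambda>k. - int k)" by (auto simp: inj_on_def)
  have sub: "f summable_on range (\<lambda>k. int k + 1)" "f summable_on range (\<lambda>k. - int k)"
    using assms by (rule summable_on_subset, simp)+
  then have 1: "(\<lambda>k. f (int k + 1)) summable_on UNIV" and 2: "(\<lambda>k. f (- int k)) summable_on UNIV"
    using inj by (simp_all add: summable_on_reindex o_def)
  then show "(\<lambda>k. f (int k + 1) + f (- int k)) summable_on UNIV"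
    by (rule summable_on_add)
  have "infsum f UNIV = infsum f (range (\<lambda>k. int k + 1)) + infsum f (range (\<lambda>k. - int k))"
    using infsum_Un_disjoint[OF sub disj] un by simp
  also have "\<dots> = (\<Sum>\<^sub>\<infinity>k. f (int k + 1)) + (\<Sum>\<^sub>\<infinity>k. f (- int k))"
    using inj by (simp add: infsum_reindex o_def)
  also have "\<dots> = (\<Sum>\<^sub>\<infinity>k. f (int k + 1) + f (- int k))"
    using 1 2 by (simp add: infsum_add)
  finally show "infsum f UNIV = (\<Sum>\<^sub>\<infinity>k. f (int k + 1) + f (- int k))" .
qed

lemma powi_odd_neq_1:
  fixes q :: real
  assumes "0 < q" "q < 1"
  shows "q powi (2 * n - 1) \<noteq> 1"
proof (cases "2 * n - 1 > 0")
  case True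
  then show ?thesis using power_int_strict_decreasing[of 0 "2 * n - 1" q] assms by simp
next
  case False
  moreover have "2 * n - 1 \<noteq> 0" by presburger
  ultimately have "2 * n - 1 < 0" by linarith
  then show ?thesis using power_int_strict_decreasing[of "2 * n - 1" 0 q] assms by simp
qed

text \<open>At \<open>s = - 1 / q\<close> the kernel \<open>\<Sum> q\<^bsup>n\<^esup> / (1 + s q\<^bsup>2n\<^esup>)\<close> vanishes, because its coefficients are odd
  under \<open>n \<mapsto> 1 - n\<close>.\<close>

lemma szego_coeff_zero:
  assumes "0 < q"
  shows "szego_coeff q (- (1 / q)) n = q powi n / (1 - q powi (2 * n - 1))"
  using assms by (simp add: szego_coeff_def power_int_diff divide_inverse mult.commute)

lemma szego_coeff_zero_pos:
  assumes "0 < q"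
  shows "szego_coeff q (- (1 / q)) (int k + 1) = q ^ Suc k / (1 - q * q ^ (2 * k))"
proof -
  have "2 * (int k + 1) - 1 = 2 * int k + 1" by simp
  then have "q powi (2 * (int k + 1) - 1) = q * q ^ (2 * k)" by (simp only: powi_odd)
  moreover have "q powi (int k + 1) = q ^ Suc k"
    using power_int_of_nat[of q "Suc k"] by (simp add: add.commute)
  ultimately show ?thesis by (simp only: szego_coeff_zero[OF assms])
qed

lemma szego_coeff_zero_neg:
  assumes "0 < q" "q < 1"
  shows "szego_coeff q (- (1 / q)) (- int k) = - szego_coeff q (- (1 / q)) (int k + 1)"
proof -
  have "2 * (- int k) - 1 = - (2 * int k + 1)" by simp
  then have "q powi (2 * (- int k) - 1) = inverse (q * q ^ (2 * k))"
    by (simp only: power_int_minus powi_odd)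
  then have neg: "szego_coeff q (- (1 / q)) (- int k) = inverse (q ^ k) / (1 - inverse (q * q ^ (2 * k)))"
    by (simp only: szego_coeff_zero[OF assms(1)] power_int_minus power_int_of_nat)
  have "inverse Q / (1 - inverse (q * (Q * Q))) = - (q * Q / (1 - q * (Q * Q)))"
    if "Q > 0" "q * (Q * Q) \<noteq> 1" for Q
    using that assms by (simp add: divide_simps) (simp add: algebra_simps)
  moreover have "q * (q ^ k * q ^ k) \<noteq> 1"
    using powi_odd_neq_1[OF assms, of "int k + 1"] powi_odd[of q k]
    by (simp add: algebra_simps flip: power_add mult_2)
  ultimately show ?thesis
    unfolding neg szego_coeff_zero_pos[OF assms(1)] using assms by (simp add: mult_2 power_add)
qed

lemma szego_coeff_zero_bound:
  assumes q: "0 < q" "q < 1"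
  shows "\<bar>szego_coeff q (- (1 / q)) n\<bar> \<le> 1 / (1 - q) * q ^ nat \<bar>n\<bar>"
proof -
  have pos: "\<bar>szego_coeff q (- (1 / q)) (int k + 1)\<bar> \<le> 1 / (1 - q) * q ^ Suc k" for k
  proof -
    have "q * q ^ (2 * k) \<le> q * 1" using q by (intro mult_left_mono power_le_one) auto
    then have "q * q ^ (2 * k) \<le> q" by (simp only: mult_1_right)
    moreover from this have "q * q ^ (2 * k) < 1" using q by linarith
    ultimately have "q ^ Suc k / (1 - q * q ^ (2 * k)) \<le> q ^ Suc k / (1 - q)" "0 \<le> q ^ Suc k / (1 - q * q ^ (2 * k))"
      using q by (auto intro!: divide_left_mono mult_pos_pos divide_nonneg_pos)
    then show ?thesis
      by (simp only: szego_coeff_zero_pos[OF q(1)] abs_of_nonneg times_divide_eq_left mult_1_left)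
  qed
  show ?thesis
  proof (cases "n > 0")
    case True
    then have "n = int (nat (n - 1)) + 1" by simp
    then obtain k where n: "n = int k + 1" by blast
    then have "nat \<bar>n\<bar> = Suc k" by simp
    then show ?thesis using pos[of k] by (simp only: n)
  next
    case False
    then have "n = - int (nat (- n))" by simp
    then obtain k where n: "n = - int k" by blast
    have "\<bar>szego_coeff q (- (1 / q)) n\<bar> \<le> 1 / (1 - q) * q ^ Suc k"
      unfolding n szego_coeff_zero_neg[OF q] using pos[of k] by simp
    also have "\<dots> \<le> 1 / (1 - q) * q ^ k"
      using q by (intro mult_left_mono power_decreasing) auto
    finally show ?thesis by (simp add: n)
  qed
qed

lemma szego_coeff_zero_nz:
  fixes q :: real
  assumes "0 < q" "q < 1"
  shows "1 + - (1 / q) * q powi (2 * n) \<noteq> 0"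
  using powi_odd_neq_1[OF assms, of n] assms by (simp add: power_int_diff)

text \<open>The double series identity is applied with \<open>\<phi> d = d^2\<close>. Expanding
  \<open>(n - m)^2\<close>, both second-moment terms carry the vanishing factor
  \<open>infsum c UNIV\<close>, and the mixed term is \<open>-2\<close> times the squared first
  moment; the factor \<open>1 / s = - q\<close> restores the sign.\<close>

lemma lambert_cubic_eq_square:
  assumes q: "0 < q" "q < 1"
  shows "lambert_cubic q = 2 / q * (\<Sum>\<^sub>\<infinity>n. of_int n * szego_coeff q (- (1 / q)) n)\<^sup>2"
proof -
  define c where "c = szego_coeff q (- (1 / q))"
  have sm: "(\<lambda>n. of_int n ^ k * c n) summable_on UNIV" for k
    unfolding c_def by (rule summable_on_szego_coeff[OF q szego_coeff_zero_bound[OF q]])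
  have c0: "c summable_on UNIV" and c1: "(\<lambda>n. of_int n * c n) summable_on UNIV"
    and c2: "(\<lambda>n. of_int n ^ 2 * c n) summable_on UNIV"
    using sm[of 0] sm[of 1] sm[of 2] by simp_all
  have "infsum c UNIV = (\<Sum>\<^sub>\<infinity>k. c (int k + 1) + c (- int k))"
    by (rule infsum_int_pair(2)[OF c0])
  also have "\<dots> = 0"
    using szego_coeff_zero_neg[OF q] by (simp add: c_def)
  finally have zero: "infsum c UNIV = 0" .
  define A where "A = (\<lambda>(n, m). of_int n ^ 2 * c n * c m)"
  define B where "B = (\<lambda>(n, m). c n * (of_int m ^ 2 * c m))"
  define D where "D = (\<lambda>(n, m). of_int n * c n * (of_int m * c m))"
  have A: "A summable_on UNIV \<times> UNIV" "infsum A (UNIV \<times> UNIV) = (\<Sum>\<^sub>\<infinity>n. of_int n ^ 2 * c n) * infsum c UNIV"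
    unfolding A_def by (rule infsum_product_real[OF c2 c0])+
  have B: "B summable_on UNIV \<times> UNIV" "infsum B (UNIV \<times> UNIV) = infsum c UNIV * (\<Sum>\<^sub>\<infinity>n. of_int n ^ 2 * c n)"
    unfolding B_def by (rule infsum_product_real[OF c0 c2])+
  have D: "D summable_on UNIV \<times> UNIV"
    "infsum D (UNIV \<times> UNIV) = (\<Sum>\<^sub>\<infinity>n. of_int n * c n) * (\<Sum>\<^sub>\<infinity>n. of_int n * c n)"
    unfolding D_def by (rule infsum_product_real[OF c1 c1])+
  have eq: "(\<lambda>(n, m). c n * c m * of_int (n - m) ^ 2) = (\<lambda>p. A p + B p + (- 2) * D p)"
    by (auto simp: A_def B_def D_def power2_eq_square algebra_simps)
  have AB: "(\<lambda>p. A p + B p) summable_on UNIV \<times> UNIV"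
    by (intro summable_on_add A B)
  have D': "(\<lambda>p. (- 2) * D p) summable_on UNIV \<times> UNIV"
    by (intro summable_on_cmult_right D)
  have "(\<lambda>(n, m). c n * c m * of_int (n - m) ^ 2) summable_on UNIV \<times> UNIV"
    unfolding eq by (intro summable_on_add AB D')
  then have "(\<Sum>\<^sub>\<infinity>(n, m)\<in>UNIV \<times> UNIV. c n * c m * of_int (n - m) ^ 2)
      = (\<Sum>\<^sub>\<infinity>d. of_int d * q powi d / (1 - q powi (2 * d)) * of_int d ^ 2) / (- (1 / q))"
    unfolding c_def
    using q szego_coeff_zero_bound[OF q] szego_coeff_zero_nz[OF q]
    by (intro infsum_szego_coeff_double[where C = "1 / (1 - q)" and \<phi> = "\<lambda>d. of_int d ^ 2"]) auto
  also have "(\<Sum>\<^sub>\<infinity>d. of_int d * q powi d / (1 - q powi (2 * d)) * of_int d ^ 2) = lambert_cubic q"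
    unfolding lambert_cubic_def by (intro infsum_cong) (simp add: power2_eq_square power3_eq_cube)
  finally have "(\<Sum>\<^sub>\<infinity>(n, m)\<in>UNIV \<times> UNIV. c n * c m * of_int (n - m) ^ 2) = - q * lambert_cubic q"
    by simp
  moreover have "(\<Sum>\<^sub>\<infinity>(n, m)\<in>UNIV \<times> UNIV. c n * c m * of_int (n - m) ^ 2)
      = - 2 * (\<Sum>\<^sub>\<infinity>n. of_int n * c n)\<^sup>2"
    unfolding eq infsum_add[OF AB D'] infsum_add[OF A(1) B(1)] infsum_cmult_right' A(2) B(2) D(2) zero
    by (simp add: power2_eq_square)
  ultimately show ?thesis using q by (simp add: c_def field_simps)
qed

lemma odd_geometric_sums:
  fixes y :: real
  assumes "0 \<le> y" "y < 1"
  shows "((\<lambda>k. of_nat (2 * k + 1) * y ^ k) has_sum (1 + y) / (1 - y)\<^sup>2) UNIV"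
proof -
  have "(\<lambda>k. 2 * (of_nat (Suc k) * y ^ k) - y ^ k) sums (2 * (1 / (1 - y)\<^sup>2) - 1 / (1 - y))"
    using assms by (intro sums_diff sums_mult geometric_deriv_sums geometric_sums) auto
  also have "2 * (1 / (1 - y)\<^sup>2) - 1 / (1 - y) = (1 + y) / (1 - y)\<^sup>2"
    using assms by (simp add: divide_simps power2_eq_square) (simp add: algebra_simps)
  also have "(\<lambda>k. 2 * (of_nat (Suc k) * y ^ k) - y ^ k) = (\<lambda>k. of_nat (2 * k + 1) * y ^ k)"
    by (simp add: algebra_simps)
  finally show ?thesis
    using assms by (intro sums_nonneg_imp_has_sum) auto
qed

text \<open>Both sides are the double series \<open>\<Sum> (2k + 1) q\<^bsup>2kj + k + j + 1\<^esup>\<close> over \<open>k, j \<ge> 0\<close>.\<close>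

lemma szego_coeff_zero_moment:
  assumes q: "0 < q" "q < 1"
  shows "(\<lambda>n. q powi n * (q powi (2 * n - 1) / (1 - q powi (2 * n - 1))\<^sup>2)) summable_on UNIV"
    and "(\<Sum>\<^sub>\<infinity>n. of_int n * szego_coeff q (- (1 / q)) n)
      = (\<Sum>\<^sub>\<infinity>n. q powi n * (q powi (2 * n - 1) / (1 - q powi (2 * n - 1))\<^sup>2))"
proof -
  define c where "c = szego_coeff q (- (1 / q))"
  define l where "l n = q powi n * (q powi (2 * n - 1) / (1 - q powi (2 * n - 1))\<^sup>2)" for n
  define y where "y k = q * q ^ (2 * k)" for k :: nat
  have y: "0 < y k" "y k < 1" "y k \<le> q" for k
  proof -
    have "q * q ^ (2 * k) \<le> q * 1" using q by (intro mult_left_mono power_le_one) auto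
    then show le: "y k \<le> q" by (simp only: y_def mult_1_right)
    show "0 < y k" using q by (simp add: y_def)
    show "y k < 1" using le q by linarith
  qed
  have l_pos: "l (int k + 1) = q ^ Suc k * (y k / (1 - y k)\<^sup>2)" for k
  proof -
    have "2 * (int k + 1) - 1 = 2 * int k + 1" by simp
    then have "q powi (2 * (int k + 1) - 1) = y k" by (simp only: powi_odd y_def)
    moreover have "q powi (int k + 1) = q ^ Suc k"
      using power_int_of_nat[of q "Suc k"] by (simp add: add.commute)
    ultimately show ?thesis by (simp only: l_def)
  qed
  have l_neg: "l (- int k) = q ^ Suc k * (1 / (1 - y k)\<^sup>2)" for k
  proof -
    have "2 * (- int k) - 1 = - (2 * int k + 1)" by simp
    then have "q powi (2 * (- int k) - 1) = inverse (y k)"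
      by (simp only: power_int_minus powi_odd y_def)
    moreover have "inverse (y k) / (1 - inverse (y k))\<^sup>2 = y k / (1 - y k)\<^sup>2"
      using y[of k] by (simp add: divide_simps power2_eq_square) (simp add: algebra_simps)
    moreover have "q powi (- int k) * y k = q ^ Suc k"
      using q by (simp add: power_int_minus y_def mult_2 power_add)
    ultimately show ?thesis by (simp add: l_def)
  qed
  have "l summable_on UNIV"
  proof (rule summable_on_int_comparison[OF q, where C = "1 / (1 - q)\<^sup>2" and k = 0])
    fix n :: int
    \<comment> \<open>Used with \<open>t = y k\<close> at \<open>n = k + 1\<close> and with
      \<open>t = 1\<close> at \<open>n = - k\<close>.\<close>
    have b: "q ^ m * (t / (1 - y k)\<^sup>2) \<le> 1 / (1 - q)\<^sup>2 * q ^ m" if "0 \<le> t" "t \<le> 1" for t k m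
    proof -
      have "(1 - q)\<^sup>2 \<le> (1 - y k)\<^sup>2" using y[of k] q by (intro power_mono) auto
      then have "t / (1 - y k)\<^sup>2 \<le> 1 / (1 - q)\<^sup>2"
        using that q y[of k] by (intro frac_le) auto
      then have "q ^ m * (t / (1 - y k)\<^sup>2) \<le> q ^ m * (1 / (1 - q)\<^sup>2)"
        using q by (intro mult_left_mono) auto
      then show ?thesis by (simp only: mult.commute)
    qed
    have nonneg: "0 \<le> q ^ m * (t / (1 - y k)\<^sup>2)" if "0 \<le> t" for t k m
      using that q by simp
    show "\<bar>l n\<bar> \<le> 1 / (1 - q)\<^sup>2 * (real_of_int \<bar>n\<bar> ^ 0 * q ^ nat \<bar>n\<bar>)"
    proof (cases "n > 0")
      case True
      then have "n = int (nat (n - 1)) + 1" by simp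
      then obtain k where n: "n = int k + 1" by blast
      then have "nat \<bar>n\<bar> = Suc k" by simp
      then show ?thesis
        using b[of "y k" "Suc k" k] nonneg[of "y k" "Suc k" k] y[of k]
        by (simp only: n l_pos abs_of_nonneg power_0 mult_1_left less_imp_le)
    next
      case False
      then have "n = - int (nat (- n))" by simp
      then obtain k where n: "n = - int k" by blast
      have "\<bar>l n\<bar> \<le> 1 / (1 - q)\<^sup>2 * q ^ Suc k"
        unfolding n l_neg using b[of 1 "Suc k" k] nonneg[of 1 "Suc k" k] by (simp only: abs_of_nonneg zero_le_one order_refl)
      also have "\<dots> \<le> 1 / (1 - q)\<^sup>2 * q ^ k"
        using q by (intro mult_left_mono power_decreasing) auto
      finally show ?thesis by (simp add: n)
    qed
  qed
  then show "(\<lambda>n. q powi n * (q powi (2 * n - 1) / (1 - q powi (2 * n - 1))\<^sup>2)) summable_on UNIV"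
    by (simp add: l_def[abs_def])
  define g where "g = (\<lambda>(k, j). real (2 * k + 1) * q ^ (2 * k * j + k + j + 1))"
  have expo: "q ^ Suc k * y k ^ j = q ^ (2 * k * j + k + j + 1)" for k j
  proof -
    have "y k ^ j = q ^ (j + 2 * k * j)"
      by (simp add: y_def power_mult_distrib power_add flip: power_mult)
    then have "q ^ Suc k * y k ^ j = q ^ (Suc k + (j + 2 * k * j))"
      by (simp only: power_add)
    also have "Suc k + (j + 2 * k * j) = 2 * k * j + k + j + 1" by simp
    finally show ?thesis .
  qed
  have inner1: "((\<lambda>j. g (k, j)) has_sum (real (2 * k + 1) * (q ^ Suc k / (1 - y k)))) UNIV" for k
  proof -
    have "((\<lambda>j. y k ^ j) has_sum (1 / (1 - y k))) UNIV"
      using y[of k] geometric_sums[of "y k"] by (intro sums_nonneg_imp_has_sum) auto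
    from has_sum_cmult_right[OF this, of "real (2 * k + 1) * q ^ Suc k"]
    have "((\<lambda>j. real (2 * k + 1) * q ^ Suc k * y k ^ j) has_sum (real (2 * k + 1) * q ^ Suc k * (1 / (1 - y k)))) UNIV" .
    moreover have "real (2 * k + 1) * q ^ Suc k * y k ^ j = g (k, j)" for j
      unfolding g_def mult.assoc expo by simp
    ultimately show ?thesis by simp
  qed
  \<comment> \<open>The exponent is symmetric in \<open>k\<close> and \<open>j\<close> while the
    weight \<open>2k + 1\<close> is not: summing over \<open>k\<close> first replaces the geometric
    series by the odd-weighted one.\<close>
  have inner2: "((\<lambda>k. g (k, j)) has_sum (q ^ Suc j * ((1 + y j) / (1 - y j)\<^sup>2))) UNIV" for j
  proof -
    have "((\<lambda>k. real (2 * k + 1) * y j ^ k) has_sum ((1 + y j) / (1 - y j)\<^sup>2)) UNIV"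
      using y[of j] by (intro odd_geometric_sums) auto
    from has_sum_cmult_right[OF this, of "q ^ Suc j"]
    have "((\<lambda>k. q ^ Suc j * (real (2 * k + 1) * y j ^ k)) has_sum (q ^ Suc j * ((1 + y j) / (1 - y j)\<^sup>2))) UNIV" .
    moreover have "q ^ Suc j * (real (2 * k + 1) * y j ^ k) = g (k, j)" for k
    proof -
      have "q ^ Suc j * (real (2 * k + 1) * y j ^ k) = real (2 * k + 1) * (q ^ Suc j * y j ^ k)"
        by (rule mult.left_commute)
      also have "\<dots> = g (k, j)"
        unfolding g_def expo by (simp add: algebra_simps)
      finally show ?thesis .
    qed
    ultimately show ?thesis by simp
  qed
  have moment: "(\<lambda>n. of_int n * c n) summable_on UNIV"
    using summable_on_szego_coeff[OF q szego_coeff_zero_bound[OF q], of 1] by (simp add: c_def)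
  \<comment> \<open>By oddness the two terms reinforce each other:
    \<open>(k + 1) + k = 2k + 1\<close>.\<close>
  have pair: "of_int (int k + 1) * c (int k + 1) + of_int (- int k) * c (- int k)
      = real (2 * k + 1) * (q ^ Suc k / (1 - y k))" for k
  proof -
    have "of_int (int k + 1) * X + of_int (- int k) * - X = real (2 * k + 1) * X" for X
      by (simp add: algebra_simps)
    then show ?thesis
      unfolding c_def szego_coeff_zero_neg[OF q] szego_coeff_zero_pos[OF q(1)] y_def .
  qed
  have outer: "(\<lambda>k. real (2 * k + 1) * (q ^ Suc k / (1 - y k))) summable_on UNIV"
    using infsum_int_pair(1)[OF moment] unfolding pair .
  have g: "g summable_on UNIV \<times> UNIV"
    by (rule summable_on_SigmaI[OF inner1 outer]) (use q in \<open>auto simp: g_def\<close>)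
  have "(\<Sum>\<^sub>\<infinity>n. of_int n * c n) = (\<Sum>\<^sub>\<infinity>k. real (2 * k + 1) * (q ^ Suc k / (1 - y k)))"
    unfolding infsum_int_pair(2)[OF moment] pair ..
  also have "\<dots> = (\<Sum>\<^sub>\<infinity>k. \<Sum>\<^sub>\<infinity>j. g (k, j))"
    using infsumI[OF inner1] by simp
  also have "\<dots> = (\<Sum>\<^sub>\<infinity>j. \<Sum>\<^sub>\<infinity>k. g (k, j))"
    by (rule infsum_swap_banach) (use g in simp)
  also have "\<dots> = (\<Sum>\<^sub>\<infinity>j. q ^ Suc j * ((1 + y j) / (1 - y j)\<^sup>2))"
    using infsumI[OF inner2] by simp
  also have "\<dots> = (\<Sum>\<^sub>\<infinity>j. l (int j + 1) + l (- int j))"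
    unfolding l_pos l_neg by (intro infsum_cong) (simp only: add_divide_distrib distrib_left add.commute)
  also have "\<dots> = infsum l UNIV"
    by (rule infsum_int_pair(2)[symmetric]) fact
  finally show "(\<Sum>\<^sub>\<infinity>n. of_int n * szego_coeff q (- (1 / q)) n)
      = (\<Sum>\<^sub>\<infinity>n. q powi n * (q powi (2 * n - 1) / (1 - q powi (2 * n - 1))\<^sup>2))"
    by (simp add: c_def l_def[abs_def])
qed

text \<open>At \<open>s = - 1 / q\<close> the numerator factor with \<open>k = 0\<close> makes both
  sides of the plain expansion vanish. Expanding the quotient without that factor divides the
  residue at \<open>n\<close> by \<open>1 - 1 / X\<close>, where
  \<open>X = q powi (2 * n - 1)\<close>, and
  \<open>1 / ((1 - 1 / X) * (1 - X)) = - X / (1 - X)^2\<close> gives the stated terms: the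
  derivative in \<open>s\<close> up to a constant.\<close>

lemma finite_szego_sum_zero:
  assumes q: "0 < q" "q < 1"
  shows "(\<Sum>n\<in>{- int (Suc M)..int (Suc M)}. q powi n * (q powi (2 * n - 1) / (1 - q powi (2 * n - 1))\<^sup>2)
      * (theta_weight q (nat (int (Suc M) - n)) * theta_weight q (nat (int (Suc M) + n))))
    = - ((\<Prod>i<Suc M. 1 - q\<^sup>2 * q ^ (2 * i)) / (\<Prod>i<Suc M. 1 - q ^ 3 * q ^ (2 * i))
      * ((\<Prod>i<M. 1 - q\<^sup>2 * q ^ (2 * i)) / (\<Prod>i<Suc (Suc M). 1 - 1 / q * q ^ (2 * i))))"
proof -
  define N where "N = Suc M"
  define s where "s = - (1 / q)"
  \<comment> \<open>The index 0 is the one with \<open>1 + s * q powi (2 * k + 1) = 0\<close>;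
    taking \<open>N = Suc M\<close> ensures that it lies in the range.\<close>
  define K where "K = {- int N..<0} \<union> {1..<int N}"
  define X where "X n = q powi (2 * n - 1)" for n
  define a where "a n = q powi n * theta_weight q (nat (int N - n)) * theta_weight q (nat (int N + n))" for n
  have s0: "s \<noteq> 0" using q by (simp add: s_def)
  have nz: "1 + s * q powi (2 * n) \<noteq> 0" for n
    using szego_coeff_zero_nz[OF q] by (simp add: s_def)
  have den: "1 + s * q powi (2 * n) = 1 - X n" for n
    using q by (simp add: s_def X_def power_int_diff)
  have X: "X n \<noteq> 0" "X n \<noteq> 1" for n
    using q powi_odd_neq_1[OF q] by (simp_all add: X_def)
  have fin: "finite K" by (simp add: K_def)
  have insK: "{- int N..<int N} = insert 0 K" "0 \<notin> K"
    by (auto simp: K_def N_def)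
  have coeff: "(\<Prod>k\<in>K. 1 - q powi (2 * k + 1) / q powi (2 * n))
      / (\<Prod>j\<in>{- int N..int N} - {n}. 1 - q powi (2 * j) / q powi (2 * n)) / (1 + s * q powi (2 * n))
    = q ^ N * (- (X n / (1 - X n)\<^sup>2 * a n))" if "n \<in> {- int N..int N}" for n
  proof -
    have "q powi (2 * 0 + 1) / q powi (2 * n) = 1 / X n"
      using q by (simp add: X_def power_int_diff)
    then have "(\<Prod>k\<in>{- int N..<int N}. 1 - q powi (2 * k + 1) / q powi (2 * n))
        = (1 - 1 / X n) * (\<Prod>k\<in>K. 1 - q powi (2 * k + 1) / q powi (2 * n))"
      unfolding insK using fin insK by simp
    moreover have "1 - 1 / X n \<noteq> 0" using X[of n] by simp
    ultimately have "(\<Prod>k\<in>K. 1 - q powi (2 * k + 1) / q powi (2 * n))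
        = (\<Prod>k\<in>{- int N..<int N}. 1 - q powi (2 * k + 1) / q powi (2 * n)) / (1 - 1 / X n)"
      by (simp add: field_simps)
    then have "(\<Prod>k\<in>K. 1 - q powi (2 * k + 1) / q powi (2 * n))
      / (\<Prod>j\<in>{- int N..int N} - {n}. 1 - q powi (2 * j) / q powi (2 * n)) / (1 + s * q powi (2 * n))
      = (\<Prod>k\<in>{- int N..<int N}. 1 - q powi (2 * k + 1) / q powi (2 * n))
      / (\<Prod>j\<in>{- int N..int N} - {n}. 1 - q powi (2 * j) / q powi (2 * n)) / (1 - 1 / X n) / (1 - X n)"
      by (simp add: den)
    also have "\<dots> = q ^ N * a n / (1 - 1 / X n) / (1 - X n)"
      using theta_weight_residue[OF q(1), of N n] that by (simp add: a_def)
    also have "\<dots> = q ^ N * (- (X n / (1 - X n)\<^sup>2 * a n))"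
      using X[of n] by (simp add: divide_simps power2_eq_square) (simp add: algebra_simps)
    finally show ?thesis .
  qed
  have "card {- int N..<int N} = Suc (card K)"
    unfolding insK(1) using fin insK(2) by (rule card_insert_disjoint)
  then have "card K < card {- int N..int N}" by simp
  then have "(\<Prod>k\<in>K. 1 + s * q powi (2 * k + 1)) / (\<Prod>i\<in>{- int N..int N}. 1 + s * q powi (2 * i))
    = (\<Sum>n\<in>{- int N..int N}. (\<Prod>k\<in>K. 1 - q powi (2 * k + 1) / q powi (2 * n))
      / (\<Prod>j\<in>{- int N..int N} - {n}. 1 - q powi (2 * j) / q powi (2 * n)) / (1 + s * q powi (2 * n)))"
    using q nz inj_on_powi_even[OF q] fin by (intro partial_fractions) auto
  also have "\<dots> = q ^ N * (- (\<Sum>n\<in>{- int N..int N}. X n / (1 - X n)\<^sup>2 * a n))"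
    unfolding sum_negf[symmetric] sum_distrib_left by (intro sum.cong refl coeff)
  also have "(\<Prod>k\<in>K. 1 + s * q powi (2 * k + 1)) / (\<Prod>i\<in>{- int N..int N}. 1 + s * q powi (2 * i))
    = ((\<Prod>k\<in>{- int N..<0}. 1 + s * q powi (2 * k + 1)) / (\<Prod>i\<in>{- int N..<0}. 1 + s * q powi (2 * i)))
      * ((\<Prod>k\<in>{1..<int N}. 1 + s * q powi (2 * k + 1)) / (\<Prod>i\<in>{0..<int N + 1}. 1 + s * q powi (2 * i)))"
  proof -
    have "{- int N..int N} = {- int N..<0} \<union> {0..<int N + 1}" by auto
    then show ?thesis by (simp add: prod.union_disjoint K_def)
  qed
  also have "(\<Prod>k\<in>{- int N..<0}. 1 + s * q powi (2 * k + 1)) / (\<Prod>i\<in>{- int N..<0}. 1 + s * q powi (2 * i))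
      = q ^ N * ((\<Prod>i<N. s + q * q ^ (2 * i)) / (\<Prod>i<N. s + q\<^sup>2 * q ^ (2 * i)))"
    unfolding prod_int_down using prod_negative_ratio[OF q(1), of s N] by (simp add: algebra_simps)
  also have "(\<Prod>i<N. s + q * q ^ (2 * i)) / (\<Prod>i<N. s + q\<^sup>2 * q ^ (2 * i))
      = (\<Prod>i<N. 1 - q\<^sup>2 * q ^ (2 * i)) / (\<Prod>i<N. 1 - q ^ 3 * q ^ (2 * i))"
  proof -
    have "s + q * q ^ (2 * i) = s * (1 - q\<^sup>2 * q ^ (2 * i))" "s + q\<^sup>2 * q ^ (2 * i) = s * (1 - q ^ 3 * q ^ (2 * i))" for i
      using q by (simp_all add: s_def power2_eq_square power3_eq_cube algebra_simps)
    then show ?thesis using s0 by (simp add: prod.distrib)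
  qed
  also have "(\<Prod>k\<in>{1..<int N}. 1 + s * q powi (2 * k + 1)) = (\<Prod>i<M. 1 - q\<^sup>2 * q ^ (2 * i))"
  proof -
    have "1 + s * q powi (2 * (1 + int i) + 1) = 1 - q\<^sup>2 * q ^ (2 * i)" for i
    proof -
      have e: "2 * (1 + int i) + 1 = 2 * int (Suc i) + 1" by simp
      show ?thesis unfolding e powi_odd using q by (simp add: s_def power2_eq_square)
    qed
    then show ?thesis by (simp only: prod_int_up) (simp add: N_def)
  qed
  also have "(\<Prod>i\<in>{0..<int N + 1}. 1 + s * q powi (2 * i)) = (\<Prod>i<Suc N. 1 - 1 / q * q ^ (2 * i))"
    by (simp add: prod_int_up nat_add_distrib power_int_mult s_def del: prod.lessThan_Suc flip: power_mult)
  finally have main: "q ^ N * ((\<Prod>i<N. 1 - q\<^sup>2 * q ^ (2 * i)) / (\<Prod>i<N. 1 - q ^ 3 * q ^ (2 * i)))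
      * ((\<Prod>i<M. 1 - q\<^sup>2 * q ^ (2 * i)) / (\<Prod>i<Suc N. 1 - 1 / q * q ^ (2 * i)))
    = q ^ N * (- (\<Sum>n\<in>{- int N..int N}. X n / (1 - X n)\<^sup>2 * a n))" .
  have "Z = - (U * V)" if "q ^ N * U * V = q ^ N * (- Z)" for U V Z
  proof -
    have "q ^ N * (U * V) = q ^ N * (- Z)" using that by (simp only: mult.assoc)
    then have "U * V = - Z" using q mult_left_cancel[of "q ^ N" "U * V" "- Z"] by auto
    then show ?thesis by simp
  qed
  from this[OF main] show ?thesis
    by (simp only: N_def X_def a_def mult_ac)
qed

text \<open>Two of the four powers of \<open>w\<close> come from the weights on the series side; the
  other two come from the product side, whose limit is \<open>q / w^2\<close>.\<close>

lemma szego_coeff_zero_moment_value: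
  assumes q: "0 < q" "q < 1"
  shows "theta_weight_lim q ^ 4 * (\<Sum>\<^sub>\<infinity>n. of_int n * szego_coeff q (- (1 / q)) n) = q"
proof -
  define P where "P z N = (\<Prod>i<N. 1 - z * q ^ (2 * i))" for z and N :: nat
  define w where "w = theta_weight_lim q"
  have P: "P z \<longlonglongrightarrow> qpoch q z" for z unfolding P_def by (rule qpoch_LIMSEQ[OF q])
  define Y where "Y = (\<Sum>\<^sub>\<infinity>n. of_int n * szego_coeff q (- (1 / q)) n)"
  define b where "b n = q powi n * (q powi (2 * n - 1) / (1 - q powi (2 * n - 1))\<^sup>2)" for n
  have q3: "q ^ 3 < 1" using power_strict_mono[of q 1 3] q by simp
  have pos: "qpoch q (q ^ 3) > 0" "qpoch q q > 0"
    using q q3 by (auto intro!: qpoch_pos)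
  have q_Suc: "qpoch q q = (1 - q) * qpoch q (q ^ 3)"
    using qpoch_Suc[OF q, of q] by (simp add: power2_eq_square power3_eq_cube mult.assoc)
  \<comment> \<open>Since \<open>1 / q > 1\<close>, the first factor of this product is negative; it
    absorbs the minus sign of the truncated identity and supplies the factor
    \<open>q\<close>.\<close>
  have qinv: "qpoch q (1 / q) = (1 - 1 / q) * qpoch q q"
    using qpoch_Suc[OF q, of "1 / q"] q by (simp add: power2_eq_square)
  have "(\<lambda>M. - (P (q\<^sup>2) (Suc M) / P (q ^ 3) (Suc M) * (P (q\<^sup>2) M / P (1 / q) (Suc (Suc M)))))
    \<longlonglongrightarrow> - (qpoch q (q\<^sup>2) / qpoch q (q ^ 3) * (qpoch q (q\<^sup>2) / qpoch q (1 / q)))"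
    using pos q
    by (intro tendsto_minus tendsto_mult tendsto_divide P LIMSEQ_Suc[OF P] LIMSEQ_Suc[OF LIMSEQ_Suc[OF P]])
      (auto simp: qinv)
  moreover have "b summable_on UNIV" "infsum b UNIV = Y"
    using szego_coeff_zero_moment[OF q] by (simp_all add: b_def[abs_def] Y_def)
  then have "(\<lambda>N. \<Sum>n\<in>{- int N..int N}. b n * (theta_weight q (nat (int N - n)) * theta_weight q (nat (int N + n))))
    \<longlonglongrightarrow> w\<^sup>2 * Y"
    using theta_weight_sum_LIMSEQ[OF q, of b] by (simp add: w_def)
  from LIMSEQ_Suc[OF this] have "(\<lambda>M. - (P (q\<^sup>2) (Suc M) / P (q ^ 3) (Suc M) * (P (q\<^sup>2) M / P (1 / q) (Suc (Suc M)))))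
    \<longlonglongrightarrow> w\<^sup>2 * Y"
    unfolding b_def finite_szego_sum_zero[OF q] P_def .
  ultimately have "w\<^sup>2 * Y = - (qpoch q (q\<^sup>2) / qpoch q (q ^ 3) * (qpoch q (q\<^sup>2) / qpoch q (1 / q)))"
    using LIMSEQ_unique by blast
  also have "\<dots> = q * (qpoch q (q\<^sup>2) / qpoch q q)\<^sup>2"
  proof -
    have "qpoch q (q ^ 3) = qpoch q q / (1 - q)" using q q_Suc by simp
    moreover have "1 - 1 / q = - (1 - q) / q" using q by (simp add: field_simps)
    moreover have "- (A / (B / t) * (A / (- t / q * B))) = q * (A / B)\<^sup>2" if "t \<noteq> 0" "B \<noteq> 0" for A B t
      using that q by (simp add: field_simps power2_eq_square)
    ultimately show ?thesis using q pos by (simp only: qinv)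
  qed
  also have "\<dots> = q * (1 / w)\<^sup>2" by (simp add: w_def theta_weight_lim_def)
  finally have "w\<^sup>2 * (w\<^sup>2 * Y) = q"
    using theta_weight_lim_pos[OF q] by (simp add: w_def power_divide)
  then show ?thesis
    by (simp add: w_def Y_def power2_eq_square power4_eq_xxxx mult.assoc)
qed

text \<open>As \<open>1 / theta_weight_lim q\<close> is \<open>\<psi>(q)\<close>, this is the
  classical identity behind the count of representations by eight triangular numbers: half of
  \<open>lambert_cubic q\<close> equals \<open>q * \<psi>(q)^8\<close>.\<close>

lemma lambert_cubic_value:
  assumes q: "0 < q" "q < 1"
  shows "lambert_cubic q = 2 * q / theta_weight_lim q ^ 8"
proof -
  define w where "w = theta_weight_lim q"
  define Y where "Y = (\<Sum>\<^sub>\<infinity>n. of_int n * szego_coeff q (- (1 / q)) n)"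
  have w: "w > 0" using theta_weight_lim_pos[OF q] by (simp add: w_def)
  have "Y = q / w ^ 4"
    using szego_coeff_zero_moment_value[OF q] w by (simp add: w_def Y_def field_simps)
  moreover have "lambert_cubic q = 2 / q * Y\<^sup>2"
    unfolding Y_def by (rule lambert_cubic_eq_square[OF q])
  ultimately have "lambert_cubic q = 2 / q * (q / w ^ 4)\<^sup>2" by simp
  also have "\<dots> = 2 * q / w ^ 8"
    using q by (simp add: power_divide power2_eq_square flip: power_mult power_add)
  finally show ?thesis by (simp add: w_def)
qed

section \<open>The asymptotics\<close>

lemma theta_shift:
  fixes q z :: real
  assumes q: "0 < q" "q < 1" and z: "z \<noteq> 0" "z \<noteq> 1"
  shows "theta q (q\<^sup>2 * z) = - theta q z / z"
proof -
  have "theta q (q\<^sup>2 * z) = qpoch q (q\<^sup>2 * z) * qpoch q (1 / z)"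
    using q by (simp add: theta_eq_qpoch)
  also have "qpoch q (1 / z) = (1 - 1 / z) * qpoch q (q\<^sup>2 / z)"
    using qpoch_Suc[OF q, of "1 / z"] by simp
  also have "1 - 1 / z = - (1 - z) / z"
    using z by (simp add: field_simps)
  also have "qpoch q (q\<^sup>2 * z) * (- (1 - z) / z * qpoch q (q\<^sup>2 / z)) = - ((1 - z) * qpoch q (q\<^sup>2 * z) * qpoch q (q\<^sup>2 / z)) / z"
    using z by (simp add: field_simps)
  also have "\<dots> = - theta q z / z"
    using qpoch_Suc[OF q, of z] q by (simp add: theta_eq_qpoch)
  finally show ?thesis .
qed

lemma theta_neg_pos:
  fixes q z :: real
  assumes q: "0 < q" "q < 1" and z: "z < 0"
  shows "theta q z > 0"
proof -
  have "q\<^sup>2 / z \<le> 0" using z by (simp add: divide_nonneg_neg)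
  then have "q\<^sup>2 / z < 1" by linarith
  then show ?thesis using q z by (simp add: theta_eq_qpoch qpoch_pos)
qed

text \<open>For a negative argument every factor is at least 1, so the product is the exponential of
  a series of nonnegative logarithms. By \<open>ln (1 + x) \<le> x\<close> this series is dominated
  by a geometric one as long as the argument stays above \<open>2 * z\<close>.\<close>

lemma isCont_qpoch_neg:
  assumes q: "0 < q" "q < 1" and z: "z < 0"
  shows "isCont (qpoch q) z"
proof -
  have eq: "qpoch q y = exp (\<Sum>\<^sub>\<infinity>n. ln (1 - y * q ^ (2 * n)))" if "y < 0" for y
  proof -
    have ge1: "1 \<le> 1 - y * q ^ (2 * n)" for n
      using that q by (simp add: mult_le_0_iff)
    then have pos: "0 < 1 - y * q ^ (2 * n)" for n by (meson less_le_trans zero_less_one)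
    have "summable (\<lambda>n. ln (1 - y * q ^ (2 * n)))"
      by (rule summable_ln_real[OF convergent_prod_qpoch[OF q] pos])
    then have "((\<lambda>n. ln (1 - y * q ^ (2 * n))) has_sum (\<Sum>n. ln (1 - y * q ^ (2 * n)))) UNIV"
      using ge1 by (intro sums_nonneg_imp_has_sum summable_sums ln_ge_zero)
    then show ?thesis
      unfolding qpoch_def prodinf_exp_real[OF convergent_prod_qpoch[OF q] pos] by (simp only: infsumI)
  qed
  have ev: "\<forall>\<^sub>F y in at z. 2 * z < y \<and> y < 0"
    using z by (intro eventually_conj order_tendstoD[OF tendsto_ident_at]) auto
  have "((\<lambda>y. \<Sum>\<^sub>\<infinity>n. ln (1 - y * q ^ (2 * n))) \<longlongrightarrow> (\<Sum>\<^sub>\<infinity>n. ln (1 - z * q ^ (2 * n)))) (at z)"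
  proof (rule tendsto_infsum_dominated)
    show "(\<lambda>n. - (2 * z) * q ^ (2 * n)) summable_on UNIV"
      using q z summable_q_powers[OF q]
      by (intro summable_on_cmult_right) (simp add: summable_on_UNIV_nonneg_real_iff)
    show "\<forall>\<^sub>F y in at z. \<forall>n\<in>UNIV. norm (ln (1 - y * q ^ (2 * n))) \<le> - (2 * z) * q ^ (2 * n)"
      using ev
    proof (eventually_elim, intro ballI)
      fix y n assume y: "2 * z < y \<and> y < 0"
      have le: "0 \<le> - y * q ^ (2 * n)" using y q by (intro mult_nonneg_nonneg) auto
      have "ln (1 + - y * q ^ (2 * n)) \<le> - y * q ^ (2 * n)"
        using le by (rule ln_add_one_self_le_self)
      also have "\<dots> \<le> - (2 * z) * q ^ (2 * n)"
        using y q by (intro mult_right_mono) auto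
      finally show "norm (ln (1 - y * q ^ (2 * n))) \<le> - (2 * z) * q ^ (2 * n)"
        using le by simp
    qed
    show "((\<lambda>y. ln (1 - y * q ^ (2 * n))) \<longlongrightarrow> ln (1 - z * q ^ (2 * n))) (at z)" for n
    proof (intro tendsto_intros)
      have "z * q ^ (2 * n) \<le> 0" using z q by (simp add: mult_le_0_iff)
      then show "1 - z * q ^ (2 * n) \<noteq> 0" by linarith
    qed
  qed
  then have "((\<lambda>y. exp (\<Sum>\<^sub>\<infinity>n. ln (1 - y * q ^ (2 * n)))) \<longlongrightarrow> qpoch q z) (at z)"
    unfolding eq[OF z] by (rule tendsto_exp)
  then show ?thesis
    unfolding isCont_def
    by (rule Lim_transform_eventually) (use ev in eventually_elim, simp add: eq)
qed

lemma isCont_theta_neg: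
  assumes q: "0 < q" "q < 1" and z: "z < 0"
  shows "isCont (theta q :: real \<Rightarrow> real) z"
proof -
  have "q\<^sup>2 / z < 0" using q z by (intro divide_pos_neg) auto
  then have "isCont (\<lambda>z. qpoch q (q\<^sup>2 / z)) z"
    using z by (intro isCont_o2[where g = "qpoch q", OF _ isCont_qpoch_neg[OF q]] continuous_intros) auto
  then have "isCont (\<lambda>z. qpoch q z * qpoch q (q\<^sup>2 / z)) z"
    by (intro continuous_intros isCont_qpoch_neg assms)
  then show ?thesis by (simp add: theta_eq_qpoch[OF q, abs_def])
qed

text \<open>Here \<open>u\<close> moves both the argument and the weight \<open>r * u\<close>, as it
  does in the one-point density, so the majorant must be uniform in both.\<close>

lemma isCont_szego_sum_diag:
  assumes q: "0 < q" "q < 1" and r: "r > 0"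
  shows "isCont (\<lambda>u. szego_sum q u (r * u)) q"
  unfolding isCont_def szego_sum_def
proof (rule tendsto_infsum_dominated)
  define \<rho> where "\<rho> = sqrt q"
  have \<rho>: "0 < \<rho>" "\<rho> < 1" "\<rho> * \<rho> = q" using q by (auto simp: \<rho>_def)
  \<comment> \<open>The map \<open>u \<mapsto> q^2 / u\<close> exchanges \<open>q * sqrt q\<close>
    and \<open>sqrt q\<close>, so on the window between them both \<open>u\<close> and
    \<open>q^2 / u\<close> stay below \<open>\<rho>\<close>.\<close>
  define m where "m = q * \<rho>"
  have "q * \<rho> < q * 1" using q \<rho> by (intro mult_strict_left_mono) auto
  then have m: "0 < m" "m < q" using q \<rho> by (simp_all add: m_def)
  have "\<rho> * \<rho> < 1 * \<rho>" using \<rho> by (intro mult_strict_right_mono) auto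
  then have \<rho>q: "q < \<rho>" using \<rho> by simp
  show "(\<lambda>n. max 1 (1 / (r * m)) * (real_of_int \<bar>n\<bar> ^ 0 * \<rho> ^ nat \<bar>n\<bar>)) summable_on UNIV"
    by (intro summable_on_cmult_right summable_on_int_power_abs \<rho>)
  have "\<forall>\<^sub>F u in at q. m < u \<and> u < \<rho>"
    using m \<rho>q by (intro eventually_conj order_tendstoD[OF tendsto_ident_at]) auto
  then show "\<forall>\<^sub>F u in at q. \<forall>n\<in>UNIV. norm (u powi n / (1 + r * u * q powi (2 * n)))
      \<le> max 1 (1 / (r * m)) * (real_of_int \<bar>n\<bar> ^ 0 * \<rho> ^ nat \<bar>n\<bar>)"
  proof (eventually_elim, intro ballI)
    fix u and n :: int assume u: "m < u \<and> u < \<rho>"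
    then have u0: "u > 0" using m by linarith
    have "q\<^sup>2 / u \<le> q\<^sup>2 / m" using u m u0 by (intro divide_left_mono) auto
    also have "q\<^sup>2 / m = q / \<rho>" using q by (simp add: m_def power2_eq_square)
    also have "\<dots> = \<rho>" using \<rho> by (simp add: field_simps)
    finally have "\<bar>u powi n / (1 + r * u * q powi (2 * n))\<bar> \<le> max 1 (1 / (r * u)) * \<rho> ^ nat \<bar>n\<bar>"
      using u u0 q r by (intro szego_term_bound) auto
    also have "\<dots> \<le> max 1 (1 / (r * m)) * \<rho> ^ nat \<bar>n\<bar>"
      using u u0 m r \<rho> by (intro mult_right_mono max.mono divide_left_mono mult_left_mono) auto
    finally show "norm (u powi n / (1 + r * u * q powi (2 * n)))
      \<le> max 1 (1 / (r * m)) * (real_of_int \<bar>n\<bar> ^ 0 * \<rho> ^ nat \<bar>n\<bar>)" by simp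
  qed
  fix n :: int
  have "0 < 1 + r * q * q powi (2 * n)"
    using q r by (intro add_pos_pos mult_pos_pos zero_less_power_int) auto
  then have "1 + r * q * q powi (2 * n) \<noteq> 0" by linarith
  then show "((\<lambda>u. u powi n / (1 + r * u * q powi (2 * n))) \<longlongrightarrow> q powi n / (1 + r * q * q powi (2 * n))) (at q)"
    using q by (intro tendsto_intros) auto
qed

section \<open>Reduction of the correlation functions to real series\<close>

lemma szego_annulus_of_real:
  "szego_annulus q (of_real a) (of_real b) s = of_real (szego_sum q (a * b) s)"
proof -
  have "szego_annulus q (of_real a) (of_real b) s
      = (\<Sum>\<^sub>\<infinity>n. complex_of_real ((a * b) powi n / (1 + s * q powi (2 * n))))"
    by (simp add: szego_annulus_def)
  also have "\<dots> = of_real (szego_sum q (a * b) s)"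
  proof (cases "(\<lambda>n. (a * b) powi n / (1 + s * q powi (2 * n))) summable_on UNIV")
    case True
    then show ?thesis
      unfolding szego_sum_def by (intro infsumI has_sum_of_real has_sum_infsum)
  next
    \<comment> \<open>Without summability both infinite sums are 0 by convention, so the identity
      holds for all real arguments.\<close>
    case False
    then have "\<not> (\<lambda>n. complex_of_real ((a * b) powi n / (1 + s * q powi (2 * n)))) summable_on UNIV"
      by (metis (no_types, lifting) Re_complex_of_real summable_on_Re summable_on_cong)
    from infsum_not_exists[OF False] infsum_not_exists[OF this] show ?thesis
      unfolding szego_sum_def by simp
  qed
  finally show ?thesis .
qed

text \<open>Parametrised by the squared modulus \<open>u\<close>, so that the points
  \<open>x\<close> and \<open>q / x\<close> become \<open>u\<close> and \<open>q^2 / u\<close>, both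
  tending to \<open>q\<close>.\<close>

definition rho_diag :: "real \<Rightarrow> real \<Rightarrow> real \<Rightarrow> real" where
  "rho_diag q r u = theta q (- r) / theta q (- r * u\<^sup>2) * (szego_sum q u (r * u))\<^sup>2"

lemma rho1_of_real:
  "rho1 q (of_real x) r = of_real (rho_diag q r (x\<^sup>2))"
  by (simp add: rho1_def rho_diag_def szego_annulus_of_real power2_eq_square power4_eq_xxxx mult.assoc)

text \<open>The two moduli multiply to \<open>q\<close>, so the weight \<open>r * q^2\<close>, the
  theta prefactor and the off-diagonal entries \<open>(F q)^2\<close> do not depend on
  \<open>x\<close>; inside the determinant only the diagonal entries move.\<close>

lemma G_wedge_of_real:
  fixes q r x :: real
  assumes "x > 0" "q > 0"
  defines "u \<equiv> x\<^sup>2" and "F \<equiv> \<lambda>u. szego_sum q u (r * q\<^sup>2)"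
  shows "G_wedge q x r = of_real (theta q (- r) / theta q (- r * q ^ 4)
    * ((F u * F (q\<^sup>2 / u))\<^sup>2 - F q ^ 4) / (rho_diag q r (q\<^sup>2 / u) * rho_diag q r u))"
proof -
  have n1: "r * (norm (complex_of_real (q / x)))\<^sup>2 * (norm (complex_of_real x))\<^sup>2 = r * q\<^sup>2"
    using assms(1) by (simp add: norm_divide power_divide)
  have n2: "- r * norm (complex_of_real (q / x)) ^ 4 * norm (complex_of_real x) ^ 4 = - r * q ^ 4"
    using assms(1) by (simp add: norm_divide power_divide)
  have sq: "q / x * (q / x) = q\<^sup>2 / u" "x * x = u" "q / x * x = q" "x * (q / x) = q" "(q / x)\<^sup>2 = q\<^sup>2 / u"
    using assms(1) by (simp_all add: u_def power2_eq_square)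
  have "det (vector [vector [of_real a, of_real b], vector [of_real c, of_real d]] :: complex ^ 2 ^ 2)
      = of_real (a * d - b * c)" for a b c d :: real
    by (simp add: det_2)
  then have "rho2 q (of_real (q / x)) (of_real x) r
      = of_real (theta q (- r) / theta q (- r * q ^ 4) * ((F (q\<^sup>2 / u))\<^sup>2 * (F u)\<^sup>2 - (F q)\<^sup>2 * (F q)\<^sup>2))"
    unfolding rho2_def Let_def n1 n2 szego_annulus_of_real sq of_real_power[symmetric] F_def
    by (simp only: of_real_mult)
  also have "(F (q\<^sup>2 / u))\<^sup>2 * (F u)\<^sup>2 - (F q)\<^sup>2 * (F q)\<^sup>2 = (F u * F (q\<^sup>2 / u))\<^sup>2 - F q ^ 4"
    by (simp add: power_mult_distrib mult.commute flip: power_add)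
  finally show ?thesis
    unfolding G_wedge_def unfolded_corr_def rho1_of_real sq by (simp add: u_def)
qed

lemma theta_weight_lim_eq:
  assumes "0 < q" "q < 1"
  shows "theta_weight_lim q ^ 4 = (theta q q)\<^sup>2 / q_zero q ^ 4"
proof -
  have "theta q q = (qpoch q q)\<^sup>2"
    using assms by (simp add: theta_eq_qpoch power2_eq_square)
  then show ?thesis
    by (simp add: theta_weight_lim_def q_zero_eq_qpoch power_divide flip: power_mult)
qed

text \<open>The constant is a product of three: \<open>q / w^8\<close> from half the Lambert series,
  \<open>4 / q\<close> from the limit of \<open>((x + sqrt q) / q)^2\<close> under the substitution
  \<open>v = x^2 / q\<close>, and \<open>1 / s\<close>.\<close>

lemma tendsto_szego_sum_defect:
  assumes q: "0 < q" "q < 1" and s: "s > 0"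
  shows "((\<lambda>x. (szego_sum q (x\<^sup>2) s * szego_sum q (q\<^sup>2 / x\<^sup>2) s - (szego_sum q q s)\<^sup>2) / (x - sqrt q)\<^sup>2)
    \<longlongrightarrow> 4 / (s * theta_weight_lim q ^ 8)) (at (sqrt q) within {sqrt q<..<1})"
proof -
  define w where "w = theta_weight_lim q"
  define Fl where "Fl = at (sqrt q) within {sqrt q<..<1}"
  define S where "S v = (\<Sum>\<^sub>\<infinity>d. of_int d * q powi d / (1 - q powi (2 * d)) * (v powi d - 1))" for v :: real
  have sq: "0 < sqrt q" "sqrt q < 1" "(sqrt q)\<^sup>2 = q" using q by auto
  have ev: "\<forall>\<^sub>F x in Fl. x \<in> {sqrt q<..<1}"
    unfolding Fl_def by (simp add: eventually_at_filter)
  have id: "((\<lambda>x. x) \<longlongrightarrow> sqrt q) Fl" unfolding Fl_def by (rule tendsto_ident_at)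
  have gt: "q < x\<^sup>2" "x\<^sup>2 < 1" "q\<^sup>2 < x\<^sup>2" if "x \<in> {sqrt q<..<1}" for x
  proof -
    have x: "sqrt q < x" "x < 1" using that by auto
    from sq(1) x(1) have "0 < x" by (rule less_trans)
    have "(sqrt q)\<^sup>2 < x\<^sup>2" using x sq by (intro power_strict_mono) auto
    then show 1: "q < x\<^sup>2" using sq by simp
    show "x\<^sup>2 < 1" using power_strict_mono[of x 1 2] x \<open>0 < x\<close> by simp
    have "q\<^sup>2 < q" using q by (simp add: power2_eq_square)
    with 1 show "q\<^sup>2 < x\<^sup>2" by linarith
  qed
  have "((\<lambda>x. x\<^sup>2 / q) \<longlongrightarrow> (sqrt q)\<^sup>2 / q) Fl"
    using q by (intro tendsto_intros id) auto
  then have "filterlim (\<lambda>x. x\<^sup>2 / q) (at_right 1) Fl"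
    unfolding filterlim_at using ev q sq gt by (auto elim!: eventually_mono)
  note filterlim_compose[OF tendsto_lambert_second_difference[OF q] this]
  then have A: "((\<lambda>x. S (x\<^sup>2 / q) / (x\<^sup>2 / q - 1)\<^sup>2) \<longlongrightarrow> lambert_cubic q / 2) Fl"
    by (simp add: S_def)
  have B: "((\<lambda>x. ((x + sqrt q) / q)\<^sup>2) \<longlongrightarrow> ((sqrt q + sqrt q) / q)\<^sup>2) Fl"
    using q by (intro tendsto_intros id) auto
  have "((\<lambda>x. S (x\<^sup>2 / q) / (x\<^sup>2 / q - 1)\<^sup>2 * ((x + sqrt q) / q)\<^sup>2 / s)
      \<longlongrightarrow> lambert_cubic q / 2 * ((sqrt q + sqrt q) / q)\<^sup>2 / s) Fl"
    using s by (intro tendsto_divide[OF tendsto_mult[OF A B] tendsto_const]) simp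
  also have "lambert_cubic q / 2 * ((sqrt q + sqrt q) / q)\<^sup>2 / s = 4 / (s * w ^ 8)"
  proof -
    have "(sqrt q + sqrt q)\<^sup>2 = 4 * q" using sq by (simp add: power2_eq_square algebra_simps)
    then show ?thesis
      using q by (simp add: lambert_cubic_value[OF q] w_def power_divide power2_eq_square)
  qed
  finally show ?thesis
    unfolding w_def Fl_def[symmetric]
  proof (rule Lim_transform_eventually)
    show "\<forall>\<^sub>F x in Fl. S (x\<^sup>2 / q) / (x\<^sup>2 / q - 1)\<^sup>2 * ((x + sqrt q) / q)\<^sup>2 / s
      = (szego_sum q (x\<^sup>2) s * szego_sum q (q\<^sup>2 / x\<^sup>2) s - (szego_sum q q s)\<^sup>2) / (x - sqrt q)\<^sup>2"
      using ev
    proof eventually_elim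
      fix x assume x: "x \<in> {sqrt q<..<1}"
      have *: "szego_sum q (x\<^sup>2) s * szego_sum q (q\<^sup>2 / x\<^sup>2) s - (szego_sum q q s)\<^sup>2 = S (x\<^sup>2 / q) / s"
        unfolding S_def by (rule szego_sum_product[OF q s gt(3)[OF x] gt(2)[OF x]])
      have "sqrt q < x" using x by simp
      with sq(1) have "x + sqrt q \<noteq> 0" by linarith
      have "x\<^sup>2 / q - 1 = (x - sqrt q) * ((x + sqrt q) / q)"
        using q sq(3) by (simp add: field_simps power2_eq_square)
      then show "S (x\<^sup>2 / q) / (x\<^sup>2 / q - 1)\<^sup>2 * ((x + sqrt q) / q)\<^sup>2 / s
        = (szego_sum q (x\<^sup>2) s * szego_sum q (q\<^sup>2 / x\<^sup>2) s - (szego_sum q q s)\<^sup>2) / (x - sqrt q)\<^sup>2"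
        unfolding * using \<open>x + sqrt q \<noteq> 0\<close> q(1) by (simp add: power_mult_distrib power_divide)
    qed
  qed
qed

lemma isCont_rho_diag:
  assumes q: "0 < q" "q < 1" and r: "r > 0"
  shows "isCont (rho_diag q r) q"
proof -
  have neg: "- r * q\<^sup>2 < 0" using q r by simp
  then have "isCont (\<lambda>u. theta q (- r * u\<^sup>2)) q"
    by (intro isCont_o2[where g = "theta q", OF _ isCont_theta_neg[OF q]] continuous_intros) auto
  then show ?thesis
    unfolding rho_diag_def[abs_def]
    using theta_neg_pos[OF q neg] isCont_szego_sum_diag[OF q r] by (intro continuous_intros) auto
qed

theorem proposition1p5:
  fixes q r :: real
  assumes "0 < q" and "q < 1" and "r > 0"
  shows "((\<lambda>x. G_wedge q x r) \<sim>[at (sqrt q) within {sqrt q<..<1}]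
            (\<lambda>x. complex_of_real (c_coeff q r * (x - sqrt q)\<^sup>2)))
         \<and> c_coeff q r > 0"
proof -
  note q = assms(1,2)
  define w where "w = theta_weight_lim q"
  define R where "R = theta q (- r)"
  define T where "T = theta q (- (q * r))"
  define F where "F u = szego_sum q u (r * q\<^sup>2)" for u
  define D where "D x = F (x\<^sup>2) * F (q\<^sup>2 / x\<^sup>2) - (F q)\<^sup>2" for x
  define Fl where "Fl = at (sqrt q) within {sqrt q<..<1}"
  have s: "r * q\<^sup>2 > 0" using assms by simp
  have w: "w > 0" unfolding w_def by (rule theta_weight_lim_pos[OF q])
  have R: "R > 0" and T: "T > 0"
    unfolding R_def T_def using assms by (auto intro!: theta_neg_pos)
  \<comment> \<open>The functional equation brings the arguments \<open>- q^2 r\<close>,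
    \<open>- q^3 r\<close> and \<open>- q^4 r\<close> back to the two values \<open>R\<close> and
    \<open>T\<close>.\<close>
  have R2: "theta q (- (q\<^sup>2 * r)) = R / r"
    using theta_shift[OF q, of "- r"] assms by (simp add: R_def)
  have qr: "q * r > 0" using assms by simp
  then have "- (q * r) \<noteq> 0" "- (q * r) \<noteq> 1" by linarith+
  from theta_shift[OF q this] have T2: "theta q (- (q * (r * q\<^sup>2))) = T / (q * r)"
    by (simp add: T_def mult_ac)
  have "q\<^sup>2 * r > 0" using assms by simp
  then have "- (q\<^sup>2 * r) \<noteq> 0" "- (q\<^sup>2 * r) \<noteq> 1" by linarith+
  from theta_shift[OF q this] have "theta q (- r * q ^ 4) = R / r / (q\<^sup>2 * r)"
    unfolding R2 by (simp add: power2_eq_square power4_eq_xxxx mult_ac)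
  then have R4: "theta q (- r * q ^ 4) = R / (r\<^sup>2 * q\<^sup>2)"
    by (simp add: power2_eq_square mult_ac)
  \<comment> \<open>The kernel at \<open>u = q\<close> is needed for two weights:
    \<open>r * q^2\<close> in the determinant, which gives a multiple of \<open>T / R\<close>, and
    \<open>r * q\<close> in the densities, which gives a multiple of \<open>R / T\<close>.\<close>
  have "w\<^sup>2 * F q = T / (q * r) / (R / r)"
    using szego_sum_q[OF q s] unfolding F_def w_def T2 unfolding mult.commute[of r "q\<^sup>2"] R2 .
  then have Fq: "F q = T / (q * R * w\<^sup>2)"
    using w assms R by (simp add: field_simps)
  have e: "q * (q * r) = q\<^sup>2 * r" by (simp add: power2_eq_square)
  have "w\<^sup>2 * szego_sum q q (q * r) = R / r / T"
    using szego_sum_q[OF q qr] unfolding w_def T_def[symmetric] e R2 .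
  then have Sq: "szego_sum q q (r * q) = R / (r * T * w\<^sup>2)"
    unfolding mult.commute[of r q] using w assms T by (simp add: field_simps)
  have "rho_diag q r q = R / (R / r) * (R / (r * T * w\<^sup>2))\<^sup>2"
    unfolding rho_diag_def Sq R_def[symmetric] minus_mult_left[symmetric] mult.commute[of r "q\<^sup>2"] R2 ..
  also have "\<dots> = R\<^sup>2 / (r * T\<^sup>2 * w ^ 4)"
    using assms R by (simp add: power_divide power_mult_distrib power2_eq_square power4_eq_xxxx)
  finally have rho: "rho_diag q r q = R\<^sup>2 / (r * T\<^sup>2 * w ^ 4)" .
  then have rho_pos: "rho_diag q r q > 0" using assms R T w by simp
  have c: "c_coeff q r = 8 * r ^ 3 * T ^ 6 / (q\<^sup>2 * R ^ 6 * w ^ 4)"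
    unfolding c_coeff_def w_def theta_weight_lim_eq[OF q] R_def T_def by (simp add: mult_ac)
  then have c_pos: "c_coeff q r > 0" using assms R T w by simp

  have sq: "0 < sqrt q" "sqrt q < 1" "(sqrt q)\<^sup>2 = q" using q by auto
  have ev: "\<forall>\<^sub>F x in Fl. x \<in> {sqrt q<..<1}"
    unfolding Fl_def by (simp add: eventually_at_filter)
  have id: "((\<lambda>x. x) \<longlongrightarrow> sqrt q) Fl" unfolding Fl_def by (rule tendsto_ident_at)
  have D: "((\<lambda>x. D x / (x - sqrt q)\<^sup>2) \<longlongrightarrow> 4 / (r * q\<^sup>2 * w ^ 8)) Fl"
    unfolding D_def F_def w_def Fl_def by (rule tendsto_szego_sum_defect[OF q s])
  have "((\<lambda>x. (x - sqrt q)\<^sup>2) \<longlongrightarrow> (sqrt q - sqrt q)\<^sup>2) Fl"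
    by (intro tendsto_intros id)
  from tendsto_mult[OF D this] have "((\<lambda>x. D x / (x - sqrt q)\<^sup>2 * (x - sqrt q)\<^sup>2) \<longlongrightarrow> 0) Fl" by simp
  \<comment> \<open>The convergence of \<open>D x / (x - sqrt q)^2\<close> already forces
    \<open>D\<close> to vanish in the limit, so \<open>D x + 2 * (F q)^2\<close> tends to
    \<open>2 * (F q)^2\<close>.\<close>
  then have D0: "(D \<longlongrightarrow> 0) Fl"
    by (rule Lim_transform_eventually) (use ev in eventually_elim, auto)
  have rho1: "((\<lambda>x. rho_diag q r (x\<^sup>2)) \<longlongrightarrow> rho_diag q r q) Fl"
    and rho2: "((\<lambda>x. rho_diag q r (q\<^sup>2 / x\<^sup>2)) \<longlongrightarrow> rho_diag q r q) Fl"
  proof -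
    have "((\<lambda>x. x\<^sup>2) \<longlongrightarrow> (sqrt q)\<^sup>2) Fl" "((\<lambda>x. q\<^sup>2 / x\<^sup>2) \<longlongrightarrow> q\<^sup>2 / (sqrt q)\<^sup>2) Fl"
      using sq by (intro tendsto_intros id; simp)+
    then have lim: "((\<lambda>x. x\<^sup>2) \<longlongrightarrow> q) Fl" "((\<lambda>x. q\<^sup>2 / x\<^sup>2) \<longlongrightarrow> q) Fl"
      using sq q by (simp_all add: power2_eq_square)
    show "((\<lambda>x. rho_diag q r (x\<^sup>2)) \<longlongrightarrow> rho_diag q r q) Fl"
      "((\<lambda>x. rho_diag q r (q\<^sup>2 / x\<^sup>2)) \<longlongrightarrow> rho_diag q r q) Fl"
      by (rule isCont_tendsto_compose[OF isCont_rho_diag[OF assms]], rule lim)+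
  qed
  have "((\<lambda>x. R / (R / (r\<^sup>2 * q\<^sup>2)) * (D x / (x - sqrt q)\<^sup>2 * (D x + 2 * (F q)\<^sup>2))
      / (rho_diag q r (q\<^sup>2 / x\<^sup>2) * rho_diag q r (x\<^sup>2)) / c_coeff q r)
    \<longlongrightarrow> R / (R / (r\<^sup>2 * q\<^sup>2)) * (4 / (r * q\<^sup>2 * w ^ 8) * (0 + 2 * (F q)\<^sup>2))
      / (rho_diag q r q * rho_diag q r q) / c_coeff q r) Fl"
    using rho_pos c_pos by (intro D D0 rho1 rho2 tendsto_intros) auto
  \<comment> \<open>The limit of the defect contributes \<open>w^8\<close> to the denominator,
    \<open>(F q)^2\<close> contributes \<open>w^4\<close>, and the two densities cancel
    \<open>w^8\<close>. The remaining \<open>w^4\<close> is \<open>theta(q)^2 / q_0^4\<close>; the 8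
    is the 4 of the defect times the 2 of \<open>2 * (F q)^2\<close>.\<close>
  also have "R / (R / (r\<^sup>2 * q\<^sup>2)) * (4 / (r * q\<^sup>2 * w ^ 8) * (0 + 2 * (F q)\<^sup>2))
      / (rho_diag q r q * rho_diag q r q) / c_coeff q r = 1"
    unfolding rho Fq c using assms R T w by (simp add: field_simps eval_nat_numeral)
  finally have "((\<lambda>x. complex_of_real (R / (R / (r\<^sup>2 * q\<^sup>2)) * (D x / (x - sqrt q)\<^sup>2 * (D x + 2 * (F q)\<^sup>2))
      / (rho_diag q r (q\<^sup>2 / x\<^sup>2) * rho_diag q r (x\<^sup>2)) / c_coeff q r)) \<longlongrightarrow> of_real 1) Fl"
    by (rule tendsto_of_real)
  moreover have "\<forall>\<^sub>F x in Fl. complex_of_real (R / (R / (r\<^sup>2 * q\<^sup>2)) * (D x / (x - sqrt q)\<^sup>2 * (D x + 2 * (F q)\<^sup>2))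
      / (rho_diag q r (q\<^sup>2 / x\<^sup>2) * rho_diag q r (x\<^sup>2)) / c_coeff q r)
      = G_wedge q x r / complex_of_real (c_coeff q r * (x - sqrt q)\<^sup>2)"
    using ev
  proof eventually_elim
    fix x assume x: "x \<in> {sqrt q<..<1}"
    then have "sqrt q < x" by simp
    with sq(1) have "x > 0" by (rule less_trans)
    have "(F (x\<^sup>2) * F (q\<^sup>2 / x\<^sup>2))\<^sup>2 - F q ^ 4 = D x * (D x + 2 * (F q)\<^sup>2)"
      by (simp add: D_def power2_eq_square power4_eq_xxxx algebra_simps)
    then show "complex_of_real (R / (R / (r\<^sup>2 * q\<^sup>2)) * (D x / (x - sqrt q)\<^sup>2 * (D x + 2 * (F q)\<^sup>2))
      / (rho_diag q r (q\<^sup>2 / x\<^sup>2) * rho_diag q r (x\<^sup>2)) / c_coeff q r)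
      = G_wedge q x r / complex_of_real (c_coeff q r * (x - sqrt q)\<^sup>2)"
      unfolding G_wedge_of_real[OF \<open>x > 0\<close> q(1)] F_def[symmetric] R4 R_def[symmetric] of_real_divide[symmetric]
      by (simp only: mult_ac times_divide_eq_left times_divide_eq_right divide_divide_eq_left)
  qed
  ultimately have "((\<lambda>x. G_wedge q x r / complex_of_real (c_coeff q r * (x - sqrt q)\<^sup>2)) \<longlongrightarrow> 1) Fl"
    by (simp add: Lim_transform_eventually)
  then show ?thesis
    using c_pos unfolding Fl_def by (intro conjI asymp_equivI')
qed

end
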